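(* For $n>0$ let $b_n\in\mathcal C_n(\mathcal K)$ be constant and let $\mathcal H_n=-\mathrm{Tr}\big(E\,U b_nU^{-1}\big)$. The Hamiltonians $$H_n=\int \mathcal H_n\,dx$$ are conserved: $\frac{d}{dt_m}H_n=0$ for all $m,n>0$.
   Context: Algebra. $\widehat{\mathcal G}$ is an affine Lie algebra, realized by matrices depending on a loop parameter $\lambda$ (no central extension), with an integral gradation $\widehat{\mathcal G}=\bigoplus_{n\in\mathbb Z}\widehat{\mathcal G}_n$ given by a grading operator $Q_{\mathbf s}$: $[Q_{\mathbf s},Y]=nY$ for $Y\in\widehat{\mathcal G}_n$; $[Q_{\mathbf s},\cdot]$ acts as a derivation on products of such matrices. Infinite sums over descending negative grades are allowed. For $Y=\sum_n Y_n$, $Y_n$ of grade $n$, put $(Y)_+=\sum_{n\ge 0}Y_n$, $(Y)_-=\sum_{n<0}Y_n$. $E\in\widehat{\mathcal G}_1$ is a constant semisimple element, so $\widehat{\mathcal G}=\mathcal K\oplus\mathcal M$ with $\mathcal K=\mathrm{Ker}(\mathrm{ad}\,E)$, $\mathcal M=\mathrm{Im}(\mathrm{ad}\,E)$; $\mathcal K_n=\mathcal K\cap\widehat{\mathcal G}_n$, $\mathcal M_n=\mathcal M\cap\widehat{\mathcal G}_n$; $\mathcal C(\mathcal K)$ is the center of $\mathcal K$ and $\mathcal C_n(\mathcal K)=\mathcal C(\mathcal K)\cap\mathcal K_n$. "Constant" means independent of $x$ and of all flow parameters. Trace. $\mathrm{Tr}(Y)=\mathrm{tr}\,(Y)_0$: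 projection on the grade-zero component followed by the ordinary matrix trace. It is cyclic and satisfies $\mathrm{Tr}(Y[Q_{\mathbf s},Z])=-\mathrm{Tr}([Q_{\mathbf s},Y]Z)$. Dressing and flows. $L=D_x+E+A$, with $D_x$ differentiation $\partial_x$ and $A=A(x)\in\mathcal M_0$. $U=\exp\big(\sum_{j\ge1}u^{(-j)}\big)$ with $u^{(-j)}\in\mathcal M_{-j}$ is the element such that $U^{-1}LU=D_x+E+K^-$ with $K^-$ in the negative-grade part of $\mathcal K$; the components of $u^{(-j)}$ are local, i.e. polynomials in the components of $A$ and their $x$-derivatives. $S=\exp\big(\sum_{j\ge1}s^{(-j)}\big)$, $s^{(-j)}\in\mathcal K_{-j}$, satisfies $S^{-1}(D_x+E+K^-)S=D_x+E$, and $\Theta=US$, so $\Theta^{-1}L\Theta=D_x+E$. For each $N>0$ for which it exists, fix a constant $b_N\in\mathcal C_N(\mathcal K)$, with $b_1=E$. The isospectral flow of $b_N$ is the derivation with $\frac{d}{dt_N}\Theta=(\Theta b_N\Theta^{-1})_-\Theta=\Theta b_N-B_N\Theta$, $B_N=(\Theta b_N\Theta^{-1})_+$, vanishing on constant elements and commuting with $[Q_{\mathbf s},\cdot]$; $\frac{d}{dt_1}=\partial_x$. Integration. $\int\cdot\,dx$ is taken under boundary conditions for which the integral of the $x$-derivative of any local expression (polynomial in the components of $A$ and their $x$-derivatives) vanishes, and $\frac{d}{dt_m}$ may be taken under the integral sign. *)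

theory Defs
  imports
    "HOL-Analysis.Analysis"
    "HOL-Computational_Algebra.Computational_Algebra"
begin

section \<open>Loop matrices\<close>

text \<open>
  The functions of \<open>x\<close> and of the flow parameters are the elements of a commutative ring \<open>'f\<close>, an
  algebra over the complex numbers via a map \<open>\<iota>\<close>; derivatives are derivations of \<open>'f\<close>.
  Since infinite sums over descending grades are allowed, a matrix depending on the loop parameter
  \<open>\<lambda>\<close> has as entries Laurent series in \<open>1 / \<lambda>\<close>: the variable \<open>fls_X\<close> stands for \<open>1 / \<lambda>\<close>.
  Products are written with \<open>**\<close> (the operation \<open>*\<close> on vectors is componentwise), and
  convergence is always meant in the product of the \<open>fls_X\<close>-adic topologies.
\<close>

type_synonym ('f, 'n) lmat = "'f fls^'n^'n"

definition complex_algebra :: "(complex \<Rightarrow> 'f::comm_ring_1) \<Rightarrow> bool" where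
  "complex_algebra \<iota> \<longleftrightarrow> \<iota> 1 = 1 \<and> (\<forall>a b. \<iota> (a + b) = \<iota> a + \<iota> b) \<and> (\<forall>a b. \<iota> (a * b) = \<iota> a * \<iota> b)"

definition derivation :: "(complex \<Rightarrow> 'f::comm_ring_1) \<Rightarrow> ('f \<Rightarrow> 'f) \<Rightarrow> bool" where
  "derivation \<iota> d \<longleftrightarrow> (\<forall>f g. d (f + g) = d f + d g) \<and> (\<forall>f g. d (f * g) = d f * g + f * d g) \<and>
     (\<forall>a. d (\<iota> a) = 0)"

text \<open>Application of a map with \<open>\<phi> 0 = 0\<close> to all coefficients of all entries; for a derivation this
  is its extension to loop matrices, \<open>\<lambda>\<close> being constant.\<close>

definition coeffwise :: "('a::zero \<Rightarrow> 'b::zero) \<Rightarrow> ('a, 'n::finite) lmat \<Rightarrow> ('b, 'n) lmat" where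
  "coeffwise \<phi> = map_matrix (\<lambda>f. Abs_fls (\<lambda>k. \<phi> (fls_nth f k)))"

definition constants :: "(complex \<Rightarrow> 'f::comm_ring_1) \<Rightarrow> ('f, 'n::finite) lmat set" where
  "constants \<iota> = range (coeffwise \<iota>)"

definition lambda_coeff :: "('f::zero, 'n::finite) lmat \<Rightarrow> int \<Rightarrow> 'f^'n^'n" where
  "lambda_coeff Y k = map_matrix (\<lambda>f. fls_nth f (- k)) Y"

definition mscale :: "'a::times \<Rightarrow> 'a^'n^'n::finite \<Rightarrow> 'a^'n^'n" where
  "mscale c = map_matrix (\<lambda>a. c * a)"

definition lie :: "'a::ring_1^'n^'n::finite \<Rightarrow> 'a^'n^'n \<Rightarrow> 'a^'n^'n" where
  "lie X Y = X ** Y - Y ** X"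

definition mexp :: "(complex \<Rightarrow> 'f::comm_ring_1) \<Rightarrow> ('f, 'n::finite) lmat \<Rightarrow> ('f, 'n) lmat" where
  "mexp \<iota> Y = (\<Sum>k. mscale (fls_const (\<iota> (1 / fact k))) (((**) Y ^^ k) (mat 1)))"


section \<open>Affine Lie algebras\<close>

definition simple_lie_algebra :: "(complex^'n^'n::finite) set \<Rightarrow> bool" where
  "simple_lie_algebra \<gg> \<longleftrightarrow>
     module.subspace mscale \<gg> \<and> (\<forall>X\<in>\<gg>. \<forall>Y\<in>\<gg>. lie X Y \<in> \<gg>) \<and>
     (\<exists>X\<in>\<gg>. \<exists>Y\<in>\<gg>. lie X Y \<noteq> 0) \<and>
     (\<forall>\<ii>. \<ii> \<subseteq> \<gg> \<and> module.subspace mscale \<ii> \<and> (\<forall>X\<in>\<gg>. \<forall>Y\<in>\<ii>. lie X Y \<in> \<ii>) \<longrightarrow> \<ii> = {0} \<or> \<ii> = \<gg>)"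

definition finite_order_automorphism ::
  "(complex^'n^'n::finite) set \<Rightarrow> (complex^'n^'n \<Rightarrow> complex^'n^'n) \<Rightarrow> nat \<Rightarrow> bool" where
  "finite_order_automorphism \<gg> \<sigma> r \<longleftrightarrow>
     r > 0 \<and> bij_betw \<sigma> \<gg> \<gg> \<and>
     (\<forall>X\<in>\<gg>. \<forall>Y\<in>\<gg>. \<sigma> (X + Y) = \<sigma> X + \<sigma> Y) \<and> (\<forall>c. \<forall>X\<in>\<gg>. \<sigma> (mscale c X) = mscale c (\<sigma> X)) \<and>
     (\<forall>X\<in>\<gg>. \<forall>Y\<in>\<gg>. \<sigma> (lie X Y) = lie (\<sigma> X) (\<sigma> Y)) \<and> (\<forall>X\<in>\<gg>. (\<sigma> ^^ r) X = X)"

definition twisted_component ::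
  "(complex^'n^'n::finite) set \<Rightarrow> (complex^'n^'n \<Rightarrow> complex^'n^'n) \<Rightarrow> nat \<Rightarrow> int \<Rightarrow> (complex^'n^'n) set" where
  "twisted_component \<gg> \<sigma> r k = {X \<in> \<gg>. \<sigma> X = mscale (cis (2 * pi * of_int k / of_nat r)) X}"

text \<open>
  By Kac's theorem the affine Lie algebras (modulo center and derivation) are the loop algebras
  of a simple Lie algebra \<open>\<gg>\<close> twisted by an automorphism \<open>\<sigma>\<close> of finite order \<open>r\<close>; the untwisted ones have
  \<open>r = 1\<close>. Here functions from \<open>'f\<close> are allowed as coefficients, and infinitely many negative
  powers of \<open>\<lambda>\<close>. For \<open>\<iota> = id\<close> this is the algebra over the complex numbers.
\<close>

definition affine_algebra ::
  "(complex \<Rightarrow> 'f::comm_ring_1) \<Rightarrow> (complex^'n^'n::finite) set \<Rightarrow> (complex^'n^'n \<Rightarrow> complex^'n^'n) \<Rightarrow> nat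
     \<Rightarrow> ('f, 'n) lmat set" where
  "affine_algebra \<iota> \<gg> \<sigma> r =
     {Y. \<forall>k. lambda_coeff Y k \<in> module.span mscale (map_matrix \<iota> ` twisted_component \<gg> \<sigma> r k)}"


section \<open>Gradation\<close>

text \<open>The grading operator acts by \<open>[Q, Y] = N \<lambda> dY/d\<lambda> + [H, Y]\<close>. In terms of \<open>z = 1 / \<lambda>\<close>, the first
  term is \<open>- N z dY/dz\<close>.\<close>

definition adQ :: "(complex \<Rightarrow> 'f::comm_ring_1) \<Rightarrow> real \<Rightarrow> complex^'n^'n::finite \<Rightarrow> ('f, 'n) lmat \<Rightarrow> ('f, 'n) lmat" where
  "adQ \<iota> N H Y = map_matrix (\<lambda>f. - fls_const (\<iota> (of_real N)) * fls_X * fls_deriv f) Y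
     + lie (map_matrix (\<lambda>a. fls_const (\<iota> a)) H) Y"

definition grade :: "(complex \<Rightarrow> 'f::comm_ring_1) \<Rightarrow> real \<Rightarrow> complex^'n^'n::finite \<Rightarrow> int \<Rightarrow> ('f, 'n) lmat set" where
  "grade \<iota> N H n = {Y. adQ \<iota> N H Y = mscale (of_int n) Y}"

text \<open>\<open>N > 0\<close> makes descending grades and descending powers of \<open>\<lambda>\<close> agree. The sum of the graded pieces
  is direct because they are eigenspaces.\<close>

definition integral_gradation ::
  "(complex^'n^'n::finite) set \<Rightarrow> (complex^'n^'n \<Rightarrow> complex^'n^'n) \<Rightarrow> nat \<Rightarrow> real \<Rightarrow> complex^'n^'n \<Rightarrow> bool" where
  "integral_gradation \<gg> \<sigma> r N H \<longleftrightarrow> N > 0 \<and>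
     (\<forall>Y \<in> affine_algebra id \<gg> \<sigma> r.
        \<exists>y. (\<forall>n. y n \<in> affine_algebra id \<gg> \<sigma> r \<inter> grade id N H n) \<and> (y has_sum Y) UNIV)"

text \<open>The decomposition into graded components is unique where it exists. It is needed for products
  of elements of the affine algebra as well, which is why it refers to all loop matrices.\<close>

definition component ::
  "(complex \<Rightarrow> 'f::comm_ring_1) \<Rightarrow> real \<Rightarrow> complex^'n^'n::finite \<Rightarrow> ('f, 'n) lmat \<Rightarrow> int \<Rightarrow> ('f, 'n) lmat" where
  "component \<iota> N H Y = (THE y. (\<forall>n. y n \<in> grade \<iota> N H n) \<and> (y has_sum Y) UNIV)"

definition negative_part ::
  "(complex \<Rightarrow> 'f::comm_ring_1) \<Rightarrow> real \<Rightarrow> complex^'n^'n::finite \<Rightarrow> ('f, 'n) lmat \<Rightarrow> ('f, 'n) lmat" where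
  "negative_part \<iota> N H Y = (\<Sum>\<^sub>\<infinity>n\<in>{..<0}. component \<iota> N H Y n)"

text \<open>The trace of a grade zero matrix does not depend on \<open>\<lambda>\<close>, since commutators are traceless; so it
  is read off as the coefficient of \<open>\<lambda>\<close> to the power 0.\<close>

definition graded_trace ::
  "(complex \<Rightarrow> 'f::comm_ring_1) \<Rightarrow> real \<Rightarrow> complex^'n^'n::finite \<Rightarrow> ('f, 'n) lmat \<Rightarrow> 'f" where
  "graded_trace \<iota> N H Y = fls_nth (trace (component \<iota> N H Y 0)) 0"


section \<open>Kernel, image and center\<close>

definition ker_ad :: "('f::comm_ring_1, 'n::finite) lmat set \<Rightarrow> ('f, 'n) lmat \<Rightarrow> ('f, 'n) lmat set" where
  "ker_ad G E = {Y \<in> G. lie E Y = 0}"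

definition im_ad :: "('f::comm_ring_1, 'n::finite) lmat set \<Rightarrow> ('f, 'n) lmat \<Rightarrow> ('f, 'n) lmat set" where
  "im_ad G E = lie E ` G"

definition center :: "('f::comm_ring_1, 'n::finite) lmat set \<Rightarrow> ('f, 'n) lmat set" where
  "center K = {Z \<in> K. \<forall>Y\<in>K. lie Z Y = 0}"

text \<open>\<open>ad E\<close> is semisimple over the field of Laurent series, i.e. diagonalizable over an algebraic
  closure of it: it is annihilated by a squarefree polynomial (characteristic zero).\<close>

definition ad_semisimple :: "(complex, 'n::finite) lmat set \<Rightarrow> (complex, 'n) lmat \<Rightarrow> bool" where
  "ad_semisimple G E \<longleftrightarrow> (\<exists>p :: complex fls poly. squarefree p \<and>
     (\<forall>Y\<in>G. (\<Sum>i\<le>degree p. mscale (poly.coeff p i) ((lie E ^^ i) Y)) = 0))"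

definition negative_completion ::
  "(complex \<Rightarrow> 'f::comm_ring_1) \<Rightarrow> real \<Rightarrow> complex^'n^'n::finite \<Rightarrow> ('f, 'n) lmat set \<Rightarrow> ('f, 'n) lmat set" where
  "negative_completion \<iota> N H K =
     {Y. \<exists>y. (\<forall>n<0. y n \<in> K \<inter> grade \<iota> N H n) \<and> (y has_sum Y) {..<0}}"


section \<open>Dressing, flows and Hamiltonians\<close>

text \<open>The differential operator \<open>D\<^sub>x + X\<close>, acting on loop matrices.\<close>

definition lax_operator ::
  "('f \<Rightarrow> 'f) \<Rightarrow> ('f::comm_ring_1, 'n::finite) lmat \<Rightarrow> ('f, 'n) lmat \<Rightarrow> ('f, 'n) lmat" where
  "lax_operator dx X = (\<lambda>V. coeffwise dx V + X ** V)"

definition conjugate_operator ::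
  "('f::comm_ring_1, 'n::finite) lmat \<Rightarrow> (('f, 'n) lmat \<Rightarrow> ('f, 'n) lmat) \<Rightarrow> ('f, 'n) lmat \<Rightarrow> ('f, 'n) lmat" where
  "conjugate_operator U L = (\<lambda>V. matrix_inv U ** L (U ** V))"

text \<open>Local expressions: the polynomials over the complex numbers in the components of \<open>A\<close> and
  their \<open>x\<close>-derivatives. Components with respect to a basis and the coefficients of the matrix
  entries are linear combinations of each other.\<close>

inductive_set local_expressions ::
  "(complex \<Rightarrow> 'f::comm_ring_1) \<Rightarrow> ('f \<Rightarrow> 'f) \<Rightarrow> ('f, 'n::finite) lmat \<Rightarrow> 'f set"
  for \<iota> dx A where
  const: "\<iota> c \<in> local_expressions \<iota> dx A"
| jet: "(dx ^^ p) (fls_nth (A $ i $ j) k) \<in> local_expressions \<iota> dx A"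
| add: "f \<in> local_expressions \<iota> dx A \<Longrightarrow> g \<in> local_expressions \<iota> dx A \<Longrightarrow> f + g \<in> local_expressions \<iota> dx A"
| mult: "f \<in> local_expressions \<iota> dx A \<Longrightarrow> g \<in> local_expressions \<iota> dx A \<Longrightarrow> f * g \<in> local_expressions \<iota> dx A"

definition flow_indices ::
  "(complex \<Rightarrow> 'f::comm_ring_1) \<Rightarrow> real \<Rightarrow> complex^'n^'n::finite \<Rightarrow> ('f, 'n) lmat set \<Rightarrow> nat set" where
  "flow_indices \<iota> N H K = {n. n > 0 \<and> (\<exists>c \<in> constants \<iota> \<inter> center K \<inter> grade \<iota> N H (int n). c \<noteq> 0)}"

text \<open>Being extended coefficientwise, \<open>d\<close> commutes with \<open>[Q, _]\<close> and vanishes on constant matrices.\<close>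

definition isospectral_flow ::
  "(complex \<Rightarrow> 'f::comm_ring_1) \<Rightarrow> real \<Rightarrow> complex^'n^'n::finite \<Rightarrow> ('f, 'n) lmat \<Rightarrow> ('f, 'n) lmat \<Rightarrow> ('f \<Rightarrow> 'f) \<Rightarrow> bool" where
  "isospectral_flow \<iota> N H \<Theta> b d \<longleftrightarrow> derivation \<iota> d \<and>
     coeffwise d \<Theta> = negative_part \<iota> N H (\<Theta> ** b ** matrix_inv \<Theta>) ** \<Theta>"

definition hamiltonian_density ::
  "(complex \<Rightarrow> 'f::comm_ring_1) \<Rightarrow> real \<Rightarrow> complex^'n^'n::finite \<Rightarrow> ('f, 'n) lmat \<Rightarrow> ('f, 'n) lmat \<Rightarrow> ('f, 'n) lmat \<Rightarrow> 'f" where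
  "hamiltonian_density \<iota> N H E U b = - graded_trace \<iota> N H (E ** U ** b ** matrix_inv U)"

text \<open>Integration over \<open>x\<close> of local expressions takes values in a group \<open>'v\<close> (of functions of the flow
  parameters, or of functionals), on which the flows act by \<open>dI\<close>.\<close>

definition integration ::
  "'f set \<Rightarrow> ('f \<Rightarrow> 'f) \<Rightarrow> nat set \<Rightarrow> (nat \<Rightarrow> 'f \<Rightarrow> 'f) \<Rightarrow> (nat \<Rightarrow> 'v \<Rightarrow> 'v) \<Rightarrow> ('f::comm_ring_1 \<Rightarrow> 'v::ab_group_add) \<Rightarrow> bool" where
  "integration Loc dx M dt dI I \<longleftrightarrow>
     (\<forall>f\<in>Loc. \<forall>g\<in>Loc. I (f + g) = I f + I g) \<and>
     (\<forall>f\<in>Loc. I (dx f) = 0) \<and>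
     (\<forall>m\<in>M. \<forall>f\<in>Loc. dI m (I f) = I (dt m f))"

end

theory Submission
  imports Defs
begin

text \<open>
  Since \<open>S\<close> commutes with the center of \<open>\<K>\<close>, the elements \<open>W = U c U\<inverse>\<close> and \<open>P = U b\<^sub>m U\<inverse>\<close> are dressed by
  \<open>\<Theta>\<close>: they are local, commute with each other and with \<open>L\<close>, and \<open>dW/dt\<^sub>m = [P\<^sub>-, W]\<close>. Hence
  \<open>- d\<H>\<^sub>n/dt\<^sub>m = Tr (E [P\<^sub>-, W])\<close>, and this is the \<open>x\<close>-derivative of the local expression
  \<open>Tr ([Q, P\<^sub>+] W)\<close>.

  All convergence and grading questions are settled coefficientwise in the powers of \<open>1 / \<lambda>\<close>. An element
  of grade \<open>n\<close> has as its coefficient of \<open>\<lambda>\<close> to the power \<open>- k\<close> an eigenvector of \<open>ad H\<close> with eigenvalue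
  \<open>n + N k\<close>; as \<open>ad H\<close> has bounded spectrum, a series of elements of decreasing grade is
  finite in each power of \<open>\<lambda>\<close>. Moreover an eigenvector with nonzero eigenvalue has trace zero, so that
  \<open>Tr\<close> is the trace of the coefficient of \<open>\<lambda>\<close> to the power 0, and is therefore cyclic.
\<close>

section \<open>Matrix rings, scalings and commutators\<close>

lemma matrix_add_rdistrib: "(A + B) ** C = A ** C + B ** C"
  for A B :: "'a::semiring_1^'n::finite^'m"
  by (vector matrix_matrix_mult_def sum.distrib distrib_right)

lemma matrix_diff_ldistrib: "A ** (B - C) = A ** B - A ** C"
  for A :: "'a::ring_1^'n::finite^'m"
  by (vector matrix_matrix_mult_def sum_subtractf right_diff_distrib)

lemma matrix_diff_rdistrib: "(A - B) ** C = A ** C - B ** C"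
  for A B :: "'a::ring_1^'n::finite^'m"
  by (vector matrix_matrix_mult_def sum_subtractf left_diff_distrib)

lemma matrix_minus_left: "(- A) ** B = - (A ** B)"
  for A :: "'a::ring_1^'n::finite^'m"
  by (vector matrix_matrix_mult_def sum_negf)

lemma matrix_minus_right: "A ** (- B) = - (A ** B)"
  for A :: "'a::ring_1^'n::finite^'m"
  by (vector matrix_matrix_mult_def sum_negf)

lemma matrix_zero_left [simp]: "0 ** A = 0" for A :: "'a::semiring_1^'n^'m::finite"
  by (vector matrix_matrix_mult_def)

lemma matrix_zero_right [simp]: "A ** 0 = 0" for A :: "'a::semiring_1^'n::finite^'m"
  by (vector matrix_matrix_mult_def)

lemmas matrix_ring_simps = matrix_add_ldistrib matrix_add_rdistrib matrix_diff_ldistrib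
  matrix_diff_rdistrib matrix_minus_left matrix_minus_right matrix_mul_assoc

lemma matrix_inv_eqI:
  fixes A B :: "'a::semiring_1^'n::finite^'n"
  assumes "A ** B = mat 1" and "B ** A = mat 1"
  shows "matrix_inv A = B"
proof -
  have "A ** matrix_inv A = mat 1 \<and> matrix_inv A ** A = mat 1"
    unfolding matrix_inv_def by (rule someI[of _ B]) (use assms in blast)
  then show ?thesis
    by (metis assms(2) matrix_mul_assoc matrix_mul_lid matrix_mul_rid)
qed

lemma mscale_add: "mscale c (X + Y) = mscale c X + mscale c Y" for c :: "'a::semiring_1"
  by (simp add: mscale_def vec_eq_iff distrib_left)

lemma mscale_add_left: "mscale (a + b) X = mscale a X + mscale b X" for a :: "'a::semiring_1"
  by (simp add: mscale_def vec_eq_iff distrib_right)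

lemma mscale_diff_left: "mscale (a - b) X = mscale a X - mscale b X" for a :: "'a::ring_1"
  by (simp add: mscale_def vec_eq_iff left_diff_distrib)

lemma mscale_sum: "mscale c (sum f F) = (\<Sum>i\<in>F. mscale c (f i))" for c :: "'a::semiring_1"
  by (induction F rule: infinite_finite_induct) (simp_all add: mscale_add, simp_all add: mscale_def vec_eq_iff)

lemma mscale_mscale: "mscale a (mscale b X) = mscale (a * b) X" for a :: "'a::semiring_1"
  by (simp add: mscale_def vec_eq_iff mult.assoc)

lemma mscale_one [simp]: "mscale 1 X = X" for X :: "'a::semiring_1^'n::finite^'n"
  by (simp add: mscale_def vec_eq_iff)

lemma mscale_zero [simp]: "mscale c 0 = 0" for c :: "'a::semiring_1"
  by (simp add: mscale_def vec_eq_iff)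

lemma mscale_mult_left: "mscale c X ** Y = mscale c (X ** Y)" for c :: "'a::comm_semiring_1"
  by (simp add: mscale_def vec_eq_iff matrix_matrix_mult_def sum_distrib_left mult.assoc)

lemma mscale_mult_right: "X ** mscale c Y = mscale c (X ** Y)" for c :: "'a::comm_semiring_1"
  by (simp add: mscale_def vec_eq_iff matrix_matrix_mult_def sum_distrib_left ac_simps)

lemma lie_add_left: "lie (X + Y) Z = lie X Z + lie Y Z"
  by (simp add: lie_def matrix_ring_simps)

lemma lie_add_right: "lie X (Y + Z) = lie X Y + lie X Z"
  by (simp add: lie_def matrix_ring_simps)

lemma lie_mscale_right: "lie X (mscale c Y) = mscale c (lie X Y)" for c :: "'a::comm_ring_1"
  unfolding lie_def mscale_mult_left mscale_mult_right
  by (simp add: mscale_def vec_eq_iff right_diff_distrib)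

lemma lie_zero_right [simp]: "lie X 0 = 0"
  by (simp add: lie_def)

lemma lie_sum_right: "lie X (sum f F) = (\<Sum>i\<in>F. lie X (f i))"
  by (induction F rule: infinite_finite_induct) (simp_all add: lie_add_right)

lemma lie_mult_right: "lie X (Y ** Z) = lie X Y ** Z + Y ** lie X Z"
  by (simp add: lie_def matrix_ring_simps)

lemma trace_lie [simp]: "trace (lie X Y) = 0" for X :: "'a::comm_ring_1^'n::finite^'n"
  by (simp add: lie_def trace_sub trace_mul_sym[of X Y])

lemma trace_zero: "trace (0 :: 'a::comm_ring_1^'n::finite^'n) = 0"
  by (simp add: trace_def)

lemma trace_mscale: "trace (mscale c X) = c * trace X" for c :: "'a::comm_ring_1"
  by (simp add: trace_def mscale_def sum_distrib_left)

lemma trace_minus: "trace (- X) = - trace X" for X :: "'a::comm_ring_1^'n::finite^'n"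
  by (simp add: trace_def sum_negf)

section \<open>Coefficients of loop matrices\<close>

text \<open>Indexed by the exponent of \<open>1 / \<lambda>\<close>, the variable of the Laurent
  series: \<open>coeff_matrix Y k\<close> is \<open>lambda_coeff Y (- k)\<close>.\<close>

definition coeff_matrix :: "('f::zero, 'n::finite) lmat \<Rightarrow> int \<Rightarrow> 'f^'n^'n" where
  "coeff_matrix Y k = map_matrix (\<lambda>f. fls_nth f k) Y"

definition of_coeffs :: "(int \<Rightarrow> 'f::zero^'n^'n::finite) \<Rightarrow> ('f, 'n) lmat" where
  "of_coeffs g = (\<chi> i j. Abs_fls (\<lambda>k. g k $ i $ j))"

lemma coeff_matrix_nth [simp]: "coeff_matrix Y k $ i $ j = fls_nth (Y $ i $ j) k"
  by (simp add: coeff_matrix_def)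

lemma lmat_eq_iff: "X = Y \<longleftrightarrow> (\<forall>k. coeff_matrix X k = coeff_matrix Y k)"
  by (auto simp: vec_eq_iff fls_eq_iff)

lemma coeff_matrix_of_coeffs:
  assumes "\<And>k. k < a \<Longrightarrow> g k = 0"
  shows "coeff_matrix (of_coeffs g) k = g k"
proof -
  have "fls_nth (Abs_fls (\<lambda>k. g k $ i $ j)) k = g k $ i $ j" for i j
    by (rule nth_Abs_fls_lower_bound[of a]) (simp add: assms)
  then show ?thesis
    by (simp add: of_coeffs_def vec_eq_iff)
qed

text \<open>There are finitely many entries, so the least of their subdegrees serves for
  all.\<close>

lemma coeff_matrix_lower_bound:
  fixes Y :: "('f::zero, 'n::finite) lmat"
  obtains a where "\<And>k. k < a \<Longrightarrow> coeff_matrix Y k = 0"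
proof -
  define a where "a = Min (range (\<lambda>(i, j). fls_subdegree (Y $ i $ j)))"
  have "a \<le> fls_subdegree (Y $ i $ j)" for i j
    unfolding a_def by (rule Min_le) (auto intro: rev_image_eqI[of "(i, j)"])
  then have "coeff_matrix Y k = 0" if "k < a" for k
    using that by (simp add: vec_eq_iff) (meson fls_eq0_below_subdegree less_le_trans)
  then show thesis by (rule that)
qed

lemma coeff_matrix_zero [simp]: "coeff_matrix 0 k = 0"
  by (simp add: vec_eq_iff)

lemma coeff_matrix_add [simp]: "coeff_matrix (X + Y) k = coeff_matrix X k + coeff_matrix Y k"
  for X :: "('f::comm_ring_1, 'n::finite) lmat"
  by (simp add: vec_eq_iff)

lemma coeff_matrix_diff [simp]: "coeff_matrix (X - Y) k = coeff_matrix X k - coeff_matrix Y k"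
  for X :: "('f::comm_ring_1, 'n::finite) lmat"
  by (simp add: vec_eq_iff)

lemma coeff_matrix_minus [simp]: "coeff_matrix (- X) k = - coeff_matrix X k"
  for X :: "('f::comm_ring_1, 'n::finite) lmat"
  by (simp add: vec_eq_iff)

lemma coeff_matrix_sum: "coeff_matrix (sum f F) k = (\<Sum>i\<in>F. coeff_matrix (f i) k)"
  for f :: "'a \<Rightarrow> ('f::comm_ring_1, 'n::finite) lmat"
  by (induction F rule: infinite_finite_induct) simp_all

lemma coeff_matrix_mscale_const [simp]:
  "coeff_matrix (mscale (fls_const c) Y) k = mscale c (coeff_matrix Y k)" for c :: "'f::comm_ring_1"
  by (simp add: vec_eq_iff mscale_def)

lemma coeff_matrix_mat_one [simp]:
  "coeff_matrix (mat 1 :: ('f::comm_ring_1, 'n::finite) lmat) k = (if k = 0 then mat 1 else 0)"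
  by (simp add: vec_eq_iff mat_def)

text \<open>The convolution runs between the exact subdegrees; terms added by looser bounds vanish.
  Loose bounds let all entries of a matrix share one range of summation.\<close>

lemma fls_nth_mult:
  fixes f g :: "'f::comm_ring_1 fls"
  assumes f: "\<And>k. k < a \<Longrightarrow> fls_nth f k = 0" and g: "\<And>k. k < b \<Longrightarrow> fls_nth g k = 0"
  shows "fls_nth (f * g) k = (\<Sum>i=a..k - b. fls_nth f i * fls_nth g (k - i))"
proof (cases "f = 0 \<or> g = 0")
  case False
  then have "a \<le> fls_subdegree f" "b \<le> fls_subdegree g"
    using f g by (meson nth_fls_subdegree_nonzero not_le)+
  then have "(\<Sum>i=fls_subdegree f..k - fls_subdegree g. fls_nth f i * fls_nth g (k - i))
      = (\<Sum>i=a..k - b. fls_nth f i * fls_nth g (k - i))"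
    by (intro sum.mono_neutral_left) auto
  then show ?thesis
    by (simp add: fls_times_nth(2))
qed auto

lemma fls_nth_sum: "fls_nth (sum f F) k = (\<Sum>i\<in>F. fls_nth (f i) k)"
  for f :: "'a \<Rightarrow> 'f::comm_ring_1 fls"
  by (induction F rule: infinite_finite_induct) simp_all

lemma coeff_matrix_mult:
  fixes X Y :: "('f::comm_ring_1, 'n::finite) lmat"
  assumes X: "\<And>k. k < a \<Longrightarrow> coeff_matrix X k = 0" and Y: "\<And>k. k < b \<Longrightarrow> coeff_matrix Y k = 0"
  shows "coeff_matrix (X ** Y) k = (\<Sum>i=a..k - b. coeff_matrix X i ** coeff_matrix Y (k - i))"
proof -
  have "fls_nth (X $ p $ r * Y $ r $ q) k
      = (\<Sum>i=a..k - b. fls_nth (X $ p $ r) i * fls_nth (Y $ r $ q) (k - i))" for p q r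
    by (rule fls_nth_mult) (use X Y in \<open>auto simp: vec_eq_iff\<close>)
  then show ?thesis
    by (auto simp: vec_eq_iff matrix_matrix_mult_def fls_nth_sum intro: sum.swap)
qed

lemma coeff_matrix_const_mult:
  "coeff_matrix (map_matrix fls_const C ** Y) k = C ** coeff_matrix Y k"
  "coeff_matrix (Y ** map_matrix fls_const C) k = coeff_matrix Y k ** C"
  for Y :: "('f::comm_ring_1, 'n::finite) lmat"
  by (simp_all add: vec_eq_iff matrix_matrix_mult_def fls_nth_sum)

lemma coeff_matrix_coeffwise:
  assumes "\<phi> 0 = 0"
  shows "coeff_matrix (coeffwise \<phi> Y) k = map_matrix \<phi> (coeff_matrix Y k)"
proof -
  have "fls_nth (Abs_fls (\<lambda>k. \<phi> (fls_nth f k))) k = \<phi> (fls_nth f k)" for f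
    by (rule nth_Abs_fls_lower_bound[of "fls_subdegree f"]) (simp add: assms)
  then show ?thesis
    by (simp add: coeffwise_def vec_eq_iff)
qed

text \<open>Two series are closer than \<open>inverse (2 ^ m)\<close> exactly when their
  coefficients agree up to exponent \<open>m\<close> inclusive. Convergence is thus eventual
  agreement up to every exponent, a purely algebraic condition.\<close>

lemma fls_tendsto_iff:
  fixes f :: "'a \<Rightarrow> 'f::comm_ring_1 fls"
  shows "(f \<longlongrightarrow> y) F \<longleftrightarrow> (\<forall>K. \<forall>\<^sub>F x in F. \<forall>k\<le>K. fls_nth (f x) k = fls_nth y k)"
proof -
  have dist_less_iff: "dist a b < inverse (2 ^ m) \<longleftrightarrow> (\<forall>k\<le>int m. fls_nth a k = fls_nth b k)"
    for a b :: "'f fls" and m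
  proof (cases "a = b")
    case False
    have "dist a b < inverse (2 ^ m) \<longleftrightarrow> int m < fls_subdegree (a - b)"
    proof (cases "fls_subdegree (a - b) \<ge> 0")
      case True
      then show ?thesis
        using False by (simp add: dist_fls_def field_simps) linarith
    next
      case neg: False
      have "inverse (2 ^ m) \<le> (2 :: real) ^ nat (- fls_subdegree (a - b))"
        by (rule order_trans[of _ 1]) (simp_all add: field_simps)
      then show ?thesis
        using False neg by (simp add: dist_fls_def not_less)
    qed
    also have "\<dots> \<longleftrightarrow> (\<forall>k\<le>int m. fls_nth (a - b) k = 0)"
      using False by (metis eq_iff_diff_eq_0 fls_eq0_below_subdegree le_less_trans not_le nth_fls_subdegree_nonzero)
    finally show ?thesis by simp
  qed simp
  show ?thesis
  proof
    assume lim: "(f \<longlongrightarrow> y) F"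
    show "\<forall>K. \<forall>\<^sub>F x in F. \<forall>k\<le>K. fls_nth (f x) k = fls_nth y k"
    proof
      fix K
      have "\<forall>\<^sub>F x in F. dist (f x) y < inverse (2 ^ nat K)"
        using lim by (rule tendstoD) simp
      then show "\<forall>\<^sub>F x in F. \<forall>k\<le>K. fls_nth (f x) k = fls_nth y k"
        by (rule eventually_mono) (simp add: dist_less_iff)
    qed
  next
    assume ev: "\<forall>K. \<forall>\<^sub>F x in F. \<forall>k\<le>K. fls_nth (f x) k = fls_nth y k"
    show "(f \<longlongrightarrow> y) F"
    proof (rule tendstoI)
      fix e :: real assume "0 < e"
      then obtain m where m: "inverse (2 ^ m) < e"
        using real_arch_pow_inv[of e "1/2"] by (auto simp: field_simps)
      from ev have "\<forall>\<^sub>F x in F. \<forall>k\<le>int m. fls_nth (f x) k = fls_nth y k" ..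
      then show "\<forall>\<^sub>F x in F. dist (f x) y < e"
        by (rule eventually_mono) (use m dist_less_iff less_trans in blast)
    qed
  qed
qed

lemma lmat_tendsto_iff:
  fixes f :: "'a \<Rightarrow> ('f::comm_ring_1, 'n::finite) lmat"
  shows "(f \<longlongrightarrow> Y) F \<longleftrightarrow> (\<forall>K. \<forall>\<^sub>F x in F. \<forall>k\<le>K. coeff_matrix (f x) k = coeff_matrix Y k)"
proof -
  have "(f \<longlongrightarrow> Y) F \<longleftrightarrow> (\<forall>i j. ((\<lambda>x. f x $ i $ j) \<longlongrightarrow> Y $ i $ j) F)"
    by (auto intro: vec_tendstoI tendsto_vec_nth)
  also have "\<dots> \<longleftrightarrow> (\<forall>K. \<forall>i j. \<forall>\<^sub>F x in F. \<forall>k\<le>K. fls_nth (f x $ i $ j) k = fls_nth (Y $ i $ j) k)"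
    unfolding fls_tendsto_iff by blast
  also have "\<dots> \<longleftrightarrow> (\<forall>K. \<forall>\<^sub>F x in F. \<forall>i j. \<forall>k\<le>K. fls_nth (f x $ i $ j) k = fls_nth (Y $ i $ j) k)"
    by (intro all_cong1) (auto intro!: eventually_all_finite elim: eventually_mono)
  also have "\<dots> \<longleftrightarrow> (\<forall>K. \<forall>\<^sub>F x in F. \<forall>k\<le>K. coeff_matrix (f x) k = coeff_matrix Y k)"
    by (intro all_cong1 eventually_cong always_eventually) (auto simp: vec_eq_iff)
  finally show ?thesis .
qed

text \<open>In the convolution with \<open>C\<close>, coefficient \<open>k\<close> involves the
  other factor only up to exponent \<open>k - a\<close>.\<close>

lemma coeff_matrix_mult_cong:
  fixes C X Y :: "('f::comm_ring_1, 'n::finite) lmat"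
  assumes C: "\<And>k. k < a \<Longrightarrow> coeff_matrix C k = 0"
    and eq: "\<And>k. k \<le> K \<Longrightarrow> coeff_matrix X k = coeff_matrix Y k" and "k \<le> K + a"
  shows "coeff_matrix (C ** X) k = coeff_matrix (C ** Y) k"
    and "coeff_matrix (X ** C) k = coeff_matrix (Y ** C) k"
proof -
  obtain b where b: "\<And>k. k < b \<Longrightarrow> coeff_matrix Y k = 0"
    by (rule coeff_matrix_lower_bound[of Y]) (rule that)
  \<comment> \<open>\<open>X\<close> is known to agree with \<open>Y\<close> only up to
    \<open>K\<close>; capping the bound at \<open>K + 1\<close> makes it valid for \<open>X\<close>
    too.\<close>
  define b' where "b' = min b (K + 1)"
  have Y: "\<And>k. k < b' \<Longrightarrow> coeff_matrix Y k = 0" and X: "\<And>k. k < b' \<Longrightarrow> coeff_matrix X k = 0"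
    using b eq by (auto simp: b'_def)
  show "coeff_matrix (C ** X) k = coeff_matrix (C ** Y) k"
    using assms(3) eq by (simp add: coeff_matrix_mult[OF C X] coeff_matrix_mult[OF C Y])
  show "coeff_matrix (X ** C) k = coeff_matrix (Y ** C) k"
    using assms(3) eq by (simp add: coeff_matrix_mult[OF X C] coeff_matrix_mult[OF Y C])
qed

lemma tendsto_matrix_mult:
  fixes f :: "'a \<Rightarrow> ('f::comm_ring_1, 'n::finite) lmat"
  assumes "(f \<longlongrightarrow> Y) F"
  shows "((\<lambda>x. C ** f x) \<longlongrightarrow> C ** Y) F" "((\<lambda>x. f x ** C) \<longlongrightarrow> Y ** C) F"
proof -
  obtain a where a: "\<And>k. k < a \<Longrightarrow> coeff_matrix C k = 0"
    by (rule coeff_matrix_lower_bound[of C]) (rule that)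
  \<comment> \<open>Controlling the product up to \<open>K\<close> requires the factor up to
    \<open>K - a\<close>, as \<open>C\<close> starts at exponent \<open>a\<close>.\<close>
  have ev: "\<forall>\<^sub>F x in F. \<forall>k\<le>K - a. coeff_matrix (f x) k = coeff_matrix Y k" for K
    using assms unfolding lmat_tendsto_iff by blast
  have "\<forall>\<^sub>F x in F. \<forall>k\<le>K. coeff_matrix (C ** f x) k = coeff_matrix (C ** Y) k" for K
    using ev[of K] by (rule eventually_mono) (auto intro!: coeff_matrix_mult_cong(1)[OF a, where K = "K - a"])
  then show "((\<lambda>x. C ** f x) \<longlongrightarrow> C ** Y) F"
    unfolding lmat_tendsto_iff by blast
  have "\<forall>\<^sub>F x in F. \<forall>k\<le>K. coeff_matrix (f x ** C) k = coeff_matrix (Y ** C) k" for K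
    using ev[of K] by (rule eventually_mono) (auto intro!: coeff_matrix_mult_cong(2)[OF a, where K = "K - a"])
  then show "((\<lambda>x. f x ** C) \<longlongrightarrow> Y ** C) F"
    unfolding lmat_tendsto_iff by blast
qed

lemma tendsto_lmat_diff:
  fixes f :: "'a \<Rightarrow> ('f::comm_ring_1, 'n::finite) lmat"
  assumes "(f \<longlongrightarrow> Y) F"
  shows "((\<lambda>x. C - f x) \<longlongrightarrow> C - Y) F"
  unfolding lmat_tendsto_iff
proof
  fix K
  show "\<forall>\<^sub>F x in F. \<forall>k\<le>K. coeff_matrix (C - f x) k = coeff_matrix (C - Y) k"
    using assms[unfolded lmat_tendsto_iff, rule_format, of K] by (rule eventually_mono) simp
qed

section \<open>Weights and graded sums\<close>

text \<open>\<open>ad H\<close> is linear on a finite-dimensional space, hence bounded, and a norm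
  bound also bounds its real eigenvalues.\<close>

lemma lie_bounded_eigenvalue:
  fixes H :: "complex^'n::finite^'n"
  obtains B where "\<And>\<mu> X. \<bar>\<mu>\<bar> > B \<Longrightarrow> lie H X = mscale (of_real \<mu>) X \<Longrightarrow> X = 0"
proof -
  have real: "mscale (of_real \<mu>) X = \<mu> *\<^sub>R X" for \<mu> and X :: "complex^'n^'n"
    by (simp add: mscale_def vec_eq_iff complex_eq_iff)
  have "linear (lie H)"
    by (rule linearI) (simp_all add: lie_add_right lie_mscale_right flip: real)
  then obtain B where B: "\<And>X. norm (lie H X) \<le> B * norm X"
    using linear_bounded by blast
  have "X = 0" if "\<bar>\<mu>\<bar> > B" "lie H X = mscale (of_real \<mu>) X" for \<mu> X
  proof (rule ccontr)
    assume "X \<noteq> 0"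
    then have "B * norm X < \<bar>\<mu>\<bar> * norm X"
      using that(1) by simp
    with B[of X] show False
      by (simp add: that(2) real)
  qed
  then show thesis by (rule that)
qed

section \<open>Complex scalars and the eigenspaces of \<open>ad H\<close>\<close>

locale loop_gradation =
  fixes \<iota> :: "complex \<Rightarrow> 'f::comm_ring_1" and N :: real and H :: "complex^'n::finite^'n"
  assumes alg: "complex_algebra \<iota>" and N_pos: "N > 0"
begin

lemma \<iota>_one [simp]: "\<iota> 1 = 1" and \<iota>_add: "\<iota> (a + b) = \<iota> a + \<iota> b" and \<iota>_mult: "\<iota> (a * b) = \<iota> a * \<iota> b"
  using alg by (simp_all add: complex_algebra_def)

lemma \<iota>_zero [simp]: "\<iota> 0 = 0"
  using \<iota>_add[of 0 0] by simp

lemma \<iota>_minus: "\<iota> (- a) = - \<iota> a"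
  using \<iota>_add[of a "- a"] by (simp add: eq_neg_iff_add_eq_0 add.commute)

lemma \<iota>_diff: "\<iota> (a - b) = \<iota> a - \<iota> b"
  using \<iota>_add[of a "- b"] by (simp add: \<iota>_minus)

lemma \<iota>_of_nat: "\<iota> (of_nat n) = of_nat n"
  by (induction n) (simp_all add: \<iota>_add)

lemma \<iota>_of_int: "\<iota> (of_int n) = of_int n"
  by (cases n) (simp_all add: \<iota>_of_nat \<iota>_minus \<iota>_diff)

lemma \<iota>_sum: "\<iota> (sum f F) = (\<Sum>i\<in>F. \<iota> (f i))"
  by (induction F rule: infinite_finite_induct) (simp_all add: \<iota>_add)

text \<open>The coefficients may have zero divisors, but the image of a nonzero complex number is a
  unit.\<close>

lemma mscale_\<iota>_eq_0_iff:
  assumes "c \<noteq> 0"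
  shows "mscale (\<iota> c) X = 0 \<longleftrightarrow> X = 0"
proof
  assume "mscale (\<iota> c) X = 0"
  then have "mscale (\<iota> (1 / c) * \<iota> c) X = 0"
    by (simp flip: mscale_mscale)
  then show "X = 0"
    using assms by (simp flip: \<iota>_mult)
qed simp

abbreviation H\<iota> :: "'f^'n^'n" where "H\<iota> \<equiv> map_matrix \<iota> H"

text \<open>On \<open>\<lambda>\<close> to the power \<open>- k\<close> the term
  \<open>N \<lambda> d/d\<lambda>\<close> acts as \<open>- N k\<close>, so grade \<open>n\<close>
  leaves \<open>n + N k\<close> as the eigenvalue of \<open>ad H\<close>.\<close>

definition weight :: "int \<Rightarrow> int \<Rightarrow> complex" where
  "weight n k = of_real (of_int n + N * of_int k)"

lemma weight_add: "weight (n + m) (k + l) = weight n k + weight m l"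
  by (simp add: weight_def algebra_simps)

lemma weight_diff: "weight n k - weight m k = of_int (n - m)"
  by (simp add: weight_def)

text \<open>The coefficient of \<open>\<lambda>\<close> to the power \<open>- k\<close> in a loop matrix of grade \<open>n\<close>.\<close>

definition weight_space :: "int \<Rightarrow> int \<Rightarrow> ('f^'n^'n) set" where
  "weight_space n k = {X. lie H\<iota> X = mscale (\<iota> (weight n k)) X}"

lemma coeff_matrix_adQ:
  "coeff_matrix (adQ \<iota> N H Y) k
    = lie H\<iota> (coeff_matrix Y k) - mscale (\<iota> (of_real (N * of_int k))) (coeff_matrix Y k)"
proof -
  have H: "map_matrix (\<lambda>a. fls_const (\<iota> a)) H = map_matrix fls_const H\<iota>"
    by (simp add: vec_eq_iff)
  have "coeff_matrix (map_matrix (\<lambda>f. - fls_const (\<iota> (of_real N)) * fls_X * fls_deriv f) Y) k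
      = - mscale (\<iota> (of_real (N * of_int k))) (coeff_matrix Y k)"
    by (simp add: vec_eq_iff mscale_def fls_X_times_conv_shift(1) \<iota>_mult \<iota>_of_int mult.assoc)
  then show ?thesis
    unfolding adQ_def H coeff_matrix_add
    by (simp add: lie_def coeff_matrix_const_mult)
qed

lemma grade_iff: "Y \<in> grade \<iota> N H n \<longleftrightarrow> (\<forall>k. coeff_matrix Y k \<in> weight_space n k)"
proof -
  have "Y \<in> grade \<iota> N H n \<longleftrightarrow> (\<forall>k. coeff_matrix (adQ \<iota> N H Y) k = coeff_matrix (mscale (fls_const (of_int n)) Y) k)"
    by (simp add: grade_def fls_of_int lmat_eq_iff)
  also have "\<dots> \<longleftrightarrow> (\<forall>k. coeff_matrix Y k \<in> weight_space n k)"
    by (simp add: coeff_matrix_adQ weight_space_def weight_def \<iota>_add \<iota>_of_int mscale_add_left diff_eq_eq add.commute)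
  finally show ?thesis .
qed

lemma weight_space_zero [simp]: "0 \<in> weight_space n k"
  by (simp add: weight_space_def)

lemma weight_space_add: "X \<in> weight_space n k \<Longrightarrow> Y \<in> weight_space n k \<Longrightarrow> X + Y \<in> weight_space n k"
  by (simp add: weight_space_def lie_add_right mscale_add)

lemma weight_space_mscale: "X \<in> weight_space n k \<Longrightarrow> mscale c X \<in> weight_space n k"
  by (simp add: weight_space_def lie_mscale_right mscale_mscale mult.commute)

lemma weight_space_mult:
  "X \<in> weight_space n k \<Longrightarrow> Y \<in> weight_space m l \<Longrightarrow> X ** Y \<in> weight_space (n + m) (k + l)"
  by (simp add: weight_space_def lie_mult_right mscale_mult_left mscale_mult_right weight_add
      \<iota>_add mscale_add_left)

text \<open>At fixed \<open>k\<close> distinct grades have weights differing by nonzero integers.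
  Applying \<open>ad H\<close> minus the weight of \<open>a\<close> removes \<open>x a\<close> and
  rescales the other terms by units, which permits induction.\<close>

lemma weight_space_independent:
  assumes "finite F" "\<And>n. n \<in> F \<Longrightarrow> x n \<in> weight_space n k" "(\<Sum>n\<in>F. x n) = 0" "n \<in> F"
  shows "x n = 0"
  using assms
proof (induction F arbitrary: x n rule: finite_induct)
  case (insert a F)
  let ?c = "\<lambda>n. \<iota> (weight n k)"
  have "0 = lie H\<iota> (\<Sum>n\<in>insert a F. x n) - mscale (?c a) (\<Sum>n\<in>insert a F. x n)"
    using insert.prems(2) by simp
  also have "\<dots> = (\<Sum>n\<in>insert a F. lie H\<iota> (x n) - mscale (?c a) (x n))"
    by (simp only: lie_sum_right mscale_sum sum_subtractf)
  also have "\<dots> = (\<Sum>n\<in>insert a F. mscale (\<iota> (of_int (n - a))) (x n))"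
    using insert.prems(1)
    by (intro sum.cong) (simp_all add: weight_space_def weight_diff flip: mscale_diff_left \<iota>_diff)
  also have "\<dots> = (\<Sum>n\<in>F. mscale (\<iota> (of_int (n - a))) (x n))"
    using insert.hyps by (simp add: mscale_def vec_eq_iff)
  finally have sum0: "(\<Sum>n\<in>F. mscale (\<iota> (of_int (n - a))) (x n)) = 0" ..
  have F0: "x m = 0" if "m \<in> F" for m
  proof -
    have "mscale (\<iota> (of_int (m - a))) (x m) = 0"
      using insert.IH[of "\<lambda>n. mscale (\<iota> (of_int (n - a))) (x n)" m] insert.prems(1) sum0 that
      by (auto intro: weight_space_mscale)
    moreover have "(of_int (m - a) :: complex) \<noteq> 0"
      using that insert.hyps by auto
    ultimately show ?thesis
      using mscale_\<iota>_eq_0_iff by blast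
  qed
  then have "x a = 0"
    using insert.prems(2) insert.hyps by simp
  with F0 insert.prems(3) show ?case by auto
qed simp

lemma weight_space_trace:
  assumes "X \<in> weight_space n 0" "n \<noteq> 0"
  shows "trace X = 0"
proof -
  have "\<iota> (of_int n) * trace X = trace (lie H\<iota> X)"
    using assms(1) by (simp add: weight_space_def weight_def trace_mscale del: trace_lie)
  then have "\<iota> (1 / of_int n) * \<iota> (of_int n) * trace X = 0"
    by (simp add: mult.assoc)
  then show ?thesis
    using assms(2) by (simp flip: \<iota>_mult)
qed

text \<open>A linear functional carries an eigenvector with coefficients in \<open>'f\<close> to a complex one.\<close>

lemma functional_exists:
  assumes "v \<noteq> 0"
  obtains f :: "'f \<Rightarrow> complex" where "\<And>x y. f (x + y) = f x + f y" "\<And>c x. f (\<iota> c * x) = c * f x" "f v \<noteq> 0"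
proof -
  interpret V: vector_space "\<lambda>c x. \<iota> c * x"
    by unfold_locales (simp_all add: \<iota>_add \<iota>_mult algebra_simps)
  interpret W: vector_space "\<lambda>c x :: complex. c * x"
    by unfold_locales (simp_all add: algebra_simps)
  interpret VW: vector_space_pair "\<lambda>c x. \<iota> c * x" "\<lambda>c x :: complex. c * x" ..
  have "V.independent {v}"
    using assms by simp
  then obtain f where f: "Vector_Spaces.linear (\<lambda>c x. \<iota> c * x) (\<lambda>c x :: complex. c * x) f" "f v = 1"
    using VW.linear_independent_extend[of "{v}" "\<lambda>_. 1"] by auto
  interpret f: Vector_Spaces.linear "\<lambda>c x. \<iota> c * x" "\<lambda>c x :: complex. c * x" f
    by (rule f(1))
  show thesis
    by (rule that[of f]) (simp_all add: f.add f.scale f(2))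
qed

lemma weight_space_bounded:
  obtains B where "\<And>n k X. \<bar>of_int n + N * of_int k\<bar> > B \<Longrightarrow> X \<in> weight_space n k \<Longrightarrow> X = 0"
proof -
  obtain B where B: "\<And>\<mu> X. \<bar>\<mu>\<bar> > B \<Longrightarrow> lie H X = mscale (of_real \<mu>) X \<Longrightarrow> X = 0"
    by (rule lie_bounded_eigenvalue[of H]) (rule that)
  have "X = 0" if "\<bar>of_int n + N * of_int k\<bar> > B" "X \<in> weight_space n k" for n k X
  proof (rule ccontr)
    let ?\<mu> = "of_int n + N * of_int k"
    assume "X \<noteq> 0"
    then obtain p q where "X $ p $ q \<noteq> 0"
      by (auto simp: vec_eq_iff)
    then obtain f :: "'f \<Rightarrow> complex" where add: "\<And>x y. f (x + y) = f x + f y"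
      and scale: "\<And>c x. f (\<iota> c * x) = c * f x" and nz: "f (X $ p $ q) \<noteq> 0"
      by (rule functional_exists) (rule that)
    have zero: "f 0 = 0"
      using scale[of 0 0] by simp
    have diff: "f (x - y) = f x - f y" for x y
      using add[of "x - y" y] by simp
    have sum: "f (sum g F) = (\<Sum>i\<in>F. f (g i))" for g and F :: "'n set"
      by (induction F rule: infinite_finite_induct) (simp_all add: add zero)
    have scale': "f (x * \<iota> c) = f x * c" for c x
      using scale[of c x] by (simp add: mult.commute)
    \<comment> \<open>\<open>f\<close> is complex linear and \<open>H\<close> has complex entries,
      so \<open>f\<close> applied entrywise commutes with \<open>ad H\<close> and keeps the
      eigenvalue.\<close>
    have "lie H (map_matrix f X) = map_matrix f (lie H\<iota> X)"
      by (simp add: lie_def vec_eq_iff matrix_matrix_mult_def diff sum scale scale')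
    also have "\<dots> = mscale (of_real ?\<mu>) (map_matrix f X)"
      using that(2) by (simp add: weight_space_def weight_def vec_eq_iff mscale_def scale)
    finally have "map_matrix f X = 0"
      using B that(1) by blast
    with nz show False
      by (simp add: vec_eq_iff)
  qed
  then show thesis by (rule that)
qed

section \<open>Finite sums of eigenvectors with admissible coefficients\<close>

definition coefficient_ring :: "'f set \<Rightarrow> bool" where
  "coefficient_ring R \<longleftrightarrow> range \<iota> \<subseteq> R \<and> (\<forall>f\<in>R. \<forall>g\<in>R. f + g \<in> R \<and> f * g \<in> R)"

lemma coefficient_ring_UNIV [simp]: "coefficient_ring UNIV"
  by (simp add: coefficient_ring_def)

context
  fixes R assumes R: "coefficient_ring R"
begin

lemma R_\<iota> [intro]: "\<iota> c \<in> R" and R_add [intro]: "f \<in> R \<Longrightarrow> g \<in> R \<Longrightarrow> f + g \<in> R"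
  and R_mult [intro]: "f \<in> R \<Longrightarrow> g \<in> R \<Longrightarrow> f * g \<in> R"
  using R by (auto simp: coefficient_ring_def)

lemma R_zero [intro]: "0 \<in> R"
  using R_\<iota>[of 0] by simp

lemma R_one [intro]: "1 \<in> R"
  using R_\<iota>[of 1] by simp

lemma R_minus [intro]: "f \<in> R \<Longrightarrow> - f \<in> R"
  using R_mult[OF R_\<iota>[of "- 1"], of f] by (simp add: \<iota>_minus)

lemma R_sum [intro]: "(\<And>i. i \<in> F \<Longrightarrow> f i \<in> R) \<Longrightarrow> sum f F \<in> R"
  by (induction F rule: infinite_finite_induct) auto

end

definition entries_in :: "'f set \<Rightarrow> ('f^'n^'n) set" where
  "entries_in R = {X. \<forall>i j. X $ i $ j \<in> R}"

text \<open>The set \<open>R\<close> of admissible coefficients is either \<open>UNIV\<close> or the ring of local expressions, so that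
  one argument yields both the gradation and the locality of dressed elements.\<close>

inductive_set weight_sums :: "int set \<Rightarrow> 'f set \<Rightarrow> int \<Rightarrow> ('f^'n^'n) set" for S R k where
  zero: "0 \<in> weight_sums S R k"
| weight: "n \<in> S \<Longrightarrow> X \<in> weight_space n k \<Longrightarrow> X \<in> entries_in R \<Longrightarrow> X \<in> weight_sums S R k"
| add: "X \<in> weight_sums S R k \<Longrightarrow> Y \<in> weight_sums S R k \<Longrightarrow> X + Y \<in> weight_sums S R k"

lemma weight_sums_mono:
  assumes "X \<in> weight_sums S R k" "S \<subseteq> S'" "R \<subseteq> R'"
  shows "X \<in> weight_sums S' R' k"
  using assms by (induction rule: weight_sums.induct) (auto intro: weight_sums.intros simp: entries_in_def subset_iff)

lemma weight_sums_sum: "(\<And>i. i \<in> F \<Longrightarrow> f i \<in> weight_sums S R k) \<Longrightarrow> sum f F \<in> weight_sums S R k"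
  by (induction F rule: infinite_finite_induct) (auto intro: weight_sums.intros)

text \<open>Summands of equal grade are merged. The family \<open>x\<close> is total with value 0
  off \<open>F\<close>, so that two decompositions add pointwise.\<close>

lemma weight_sums_decompose:
  assumes R: "coefficient_ring R" and "X \<in> weight_sums S R k"
  obtains F x where "finite F" "F \<subseteq> S" "\<And>n. x n \<in> weight_space n k" "\<And>n. x n \<in> entries_in R"
    "\<And>n. n \<notin> F \<Longrightarrow> x n = 0" "X = (\<Sum>n\<in>F. x n)"
proof -
  have "\<exists>F x. finite F \<and> F \<subseteq> S \<and> (\<forall>n. x n \<in> weight_space n k \<and> x n \<in> entries_in R \<and> (n \<notin> F \<longrightarrow> x n = 0))
      \<and> X = (\<Sum>n\<in>F. x n)"
    using assms(2)
  proof (induction rule: weight_sums.induct)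
    case zero
    show ?case
      by (intro exI[of _ "{}"] exI[of _ "\<lambda>_. 0"]) (auto simp: entries_in_def R_zero[OF R])
  next
    case (weight n X)
    then show ?case
      by (intro exI[of _ "{n}"] exI[of _ "\<lambda>m. if m = n then X else 0"])
         (auto simp: entries_in_def R_zero[OF R])
  next
    case (add X Y)
    then obtain F x F' y where F: "finite F" "F \<subseteq> S" "X = (\<Sum>n\<in>F. x n)"
      and x: "\<And>n. x n \<in> weight_space n k \<and> x n \<in> entries_in R \<and> (n \<notin> F \<longrightarrow> x n = 0)"
      and F': "finite F'" "F' \<subseteq> S" "Y = (\<Sum>n\<in>F'. y n)"
      and y: "\<And>n. y n \<in> weight_space n k \<and> y n \<in> entries_in R \<and> (n \<notin> F' \<longrightarrow> y n = 0)"
      by blast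
    have "X = (\<Sum>n\<in>F \<union> F'. x n)" "Y = (\<Sum>n\<in>F \<union> F'. y n)"
      unfolding F(3) F'(3) using F(1) F'(1) x y by (auto intro!: sum.mono_neutral_left)
    then have "X + Y = (\<Sum>n\<in>F \<union> F'. x n + y n)"
      by (simp add: sum.distrib)
    moreover have "x n + y n \<in> entries_in R" for n
      using x[of n] y[of n] by (simp add: entries_in_def R_add[OF R])
    ultimately show ?case
      using F F' x y
      by (intro exI[of _ "F \<union> F'"] exI[of _ "\<lambda>n. x n + y n"]) (auto intro: weight_space_add)
  qed
  then show thesis using that by blast
qed

end

section \<open>Loop matrices with prescribed grades and coefficients\<close>

context loop_gradation
begin

text \<open>Each coefficient is a finite sum over grades, but the grades occurring may vary with
  \<open>k\<close>; this accommodates infinite descending sums without mentioning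
  convergence.\<close>

definition graded_in :: "int set \<Rightarrow> 'f set \<Rightarrow> ('f, 'n) lmat set" where
  "graded_in S R = {Y. \<forall>k. coeff_matrix Y k \<in> weight_sums S R k}"

lemma graded_in_mono: "Y \<in> graded_in S R \<Longrightarrow> S \<subseteq> S' \<Longrightarrow> R \<subseteq> R' \<Longrightarrow> Y \<in> graded_in S' R'"
  by (auto simp: graded_in_def intro: weight_sums_mono)

lemma graded_in_grade:
  fixes Y :: "('f, 'n) lmat"
  assumes "Y \<in> grade \<iota> N H n" "\<And>i j k. fls_nth (Y $ i $ j) k \<in> R" "n \<in> S"
  shows "Y \<in> graded_in S R"
  using assms by (auto simp: graded_in_def grade_iff entries_in_def intro: weight_sums.weight)

lemma graded_in_zero [simp]: "0 \<in> graded_in S R"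
  by (simp add: graded_in_def weight_sums.zero)

lemma graded_in_add: "X \<in> graded_in S R \<Longrightarrow> Y \<in> graded_in S R \<Longrightarrow> X + Y \<in> graded_in S R"
  by (simp add: graded_in_def weight_sums.add)

lemma graded_in_sum: "(\<And>i. i \<in> F \<Longrightarrow> f i \<in> graded_in S R) \<Longrightarrow> sum f F \<in> graded_in S R"
  by (induction F rule: infinite_finite_induct) (auto intro: graded_in_add)

lemma weight_sums_mscale:
  assumes "coefficient_ring R" "X \<in> weight_sums S R k"
  shows "mscale (\<iota> c) X \<in> weight_sums S R k"
  using assms(2)
proof (induction rule: weight_sums.induct)
  case (weight n X)
  then show ?case
    by (intro weight_sums.weight[of n])
       (auto simp: entries_in_def mscale_def R_mult[OF assms(1)] R_\<iota>[OF assms(1)] intro: weight_space_mscale[unfolded mscale_def])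
qed (auto simp: mscale_add intro: weight_sums.intros)

lemma graded_in_mscale:
  "coefficient_ring R \<Longrightarrow> Y \<in> graded_in S R \<Longrightarrow> mscale (fls_const (\<iota> c)) Y \<in> graded_in S R"
  by (simp add: graded_in_def weight_sums_mscale)

lemma graded_in_minus: "coefficient_ring R \<Longrightarrow> Y \<in> graded_in S R \<Longrightarrow> - Y \<in> graded_in S R"
proof -
  have "mscale (fls_const (\<iota> (- 1))) Y = - Y"
    by (simp add: mscale_def vec_eq_iff \<iota>_minus)
  then show "coefficient_ring R \<Longrightarrow> Y \<in> graded_in S R \<Longrightarrow> - Y \<in> graded_in S R"
    using graded_in_mscale[of R Y S "- 1"] by simp
qed

lemma graded_in_diff:
  "coefficient_ring R \<Longrightarrow> X \<in> graded_in S R \<Longrightarrow> Y \<in> graded_in S R \<Longrightarrow> X - Y \<in> graded_in S R"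
  using graded_in_add[of X S R "- Y"] graded_in_minus by simp

lemma weight_sums_mult:
  assumes R: "coefficient_ring R" and S: "\<And>n m. n \<in> S \<Longrightarrow> m \<in> S' \<Longrightarrow> n + m \<in> S''"
    and "X \<in> weight_sums S R k" "Y \<in> weight_sums S' R l"
  shows "X ** Y \<in> weight_sums S'' R (k + l)"
  using assms(3)
proof (induction rule: weight_sums.induct)
  case (weight n X)
  show ?case
    using assms(4)
  proof (induction rule: weight_sums.induct)
    case (weight m Y)
    have "X ** Y \<in> entries_in R"
      using \<open>X \<in> entries_in R\<close> \<open>Y \<in> entries_in R\<close>
      by (auto simp: entries_in_def matrix_matrix_mult_def intro!: R_sum[OF R] R_mult[OF R])
    then show ?case
      using S \<open>n \<in> S\<close> \<open>m \<in> S'\<close> \<open>X \<in> weight_space n k\<close> \<open>Y \<in> weight_space m l\<close>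
      by (intro weight_sums.weight[of "n + m"] weight_space_mult)
  qed (simp_all add: matrix_add_ldistrib weight_sums.intros)
qed (simp_all add: matrix_add_rdistrib weight_sums.intros)

lemma graded_in_mult:
  assumes R: "coefficient_ring R" and S: "\<And>n m. n \<in> S \<Longrightarrow> m \<in> S' \<Longrightarrow> n + m \<in> S''"
    and X: "X \<in> graded_in S R" and Y: "Y \<in> graded_in S' R"
  shows "X ** Y \<in> graded_in S'' R"
proof -
  obtain a where a: "\<And>k. k < a \<Longrightarrow> coeff_matrix X k = 0"
    by (rule coeff_matrix_lower_bound[of X]) (rule that)
  obtain b where b: "\<And>k. k < b \<Longrightarrow> coeff_matrix Y k = 0"
    by (rule coeff_matrix_lower_bound[of Y]) (rule that)
  have "coeff_matrix X i ** coeff_matrix Y (k - i) \<in> weight_sums S'' R k" for i k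
    using weight_sums_mult[OF R S, where X = "coeff_matrix X i" and k = i and Y = "coeff_matrix Y (k - i)" and l = "k - i"] X Y
    by (simp add: graded_in_def)
  then show ?thesis
    by (simp add: graded_in_def coeff_matrix_mult[OF a b] weight_sums_sum)
qed

lemma graded_in_mat_one:
  assumes "coefficient_ring R" "0 \<in> S"
  shows "mat 1 \<in> graded_in S R"
proof -
  have "mat 1 \<in> weight_space 0 0"
    by (simp add: weight_space_def weight_def lie_def) (simp add: mscale_def vec_eq_iff)
  moreover have "mat 1 \<in> entries_in R"
    using R_zero[OF assms(1)] R_one[OF assms(1)] by (simp add: entries_in_def mat_def)
  ultimately show ?thesis
    using assms(2) weight_sums.weight[of 0 S "mat 1" 0 R] by (simp add: graded_in_def weight_sums.zero)
qed

lemma graded_in_entries: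
  fixes Y :: "('f, 'n) lmat"
  assumes "coefficient_ring R" "Y \<in> graded_in S R"
  shows "fls_nth (Y $ i $ j) k \<in> R"
proof -
  have "coeff_matrix Y k \<in> entries_in R"
    using assms(2)[unfolded graded_in_def, simplified, rule_format, of k]
    by (induction rule: weight_sums.induct)
       (auto simp: entries_in_def R_zero[OF assms(1)] R_add[OF assms(1)])
  then show ?thesis
    by (simp add: entries_in_def)
qed

text \<open>Each coefficient is eventually constant along \<open>F\<close>, so that of the limit is
  already attained by some \<open>f x\<close>.\<close>

lemma graded_in_tendsto:
  assumes lim: "(f \<longlongrightarrow> Y) F" and ev: "\<forall>\<^sub>F x in F. f x \<in> graded_in S R" and "F \<noteq> bot"
  shows "Y \<in> graded_in S R"
proof -
  have "coeff_matrix Y k \<in> weight_sums S R k" for k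
  proof -
    have "\<forall>\<^sub>F x in F. coeff_matrix (f x) k = coeff_matrix Y k"
      using lim[unfolded lmat_tendsto_iff, rule_format, of k] by (rule eventually_mono) simp
    with ev have "\<forall>\<^sub>F x in F. f x \<in> graded_in S R \<and> coeff_matrix (f x) k = coeff_matrix Y k"
      by (rule eventually_conj)
    from eventually_happens'[OF \<open>F \<noteq> bot\<close> this] show ?thesis
      by (auto simp: graded_in_def) metis
  qed
  then show ?thesis
    by (simp add: graded_in_def)
qed

lemma graded_in_infsum:
  assumes "\<And>j. j \<in> T \<Longrightarrow> f j \<in> graded_in S R"
  shows "(\<Sum>\<^sub>\<infinity>j\<in>T. f j) \<in> graded_in S R"
proof (cases "f summable_on T")
  case True
  then have "(sum f \<longlongrightarrow> (\<Sum>\<^sub>\<infinity>j\<in>T. f j)) (finite_subsets_at_top T)"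
    by (rule has_sum_infsum[unfolded has_sum_def])
  moreover have "\<forall>\<^sub>F F in finite_subsets_at_top T. sum f F \<in> graded_in S R"
    by (rule eventually_finite_subsets_at_top_weakI) (use assms in \<open>auto intro: graded_in_sum\<close>)
  ultimately show ?thesis
    by (rule graded_in_tendsto) simp
\<comment> \<open>A family that is not summable has sum 0 by convention, and 0 lies in every
  \<open>graded_in S R\<close>.\<close>
qed (simp add: infsum_not_exists)

section \<open>Existence and uniqueness of graded components\<close>

lemma has_sum_coeff_matrix:
  assumes "((y :: 'i \<Rightarrow> ('f, 'n) lmat) has_sum Y) T"
  obtains F where "finite F" "F \<subseteq> T" "\<And>n. n \<in> T - F \<Longrightarrow> coeff_matrix (y n) k = 0"
    "coeff_matrix Y k = (\<Sum>n\<in>F. coeff_matrix (y n) k)"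
proof -
  have "\<forall>\<^sub>F F in finite_subsets_at_top T. coeff_matrix (sum y F) k = coeff_matrix Y k"
    using assms[unfolded has_sum_def lmat_tendsto_iff, rule_format, of k] by (rule eventually_mono) simp
  then obtain F where F: "finite F" "F \<subseteq> T"
    and eq: "\<And>F'. finite F' \<Longrightarrow> F \<subseteq> F' \<Longrightarrow> F' \<subseteq> T \<Longrightarrow> coeff_matrix (sum y F') k = coeff_matrix Y k"
    by (auto simp: eventually_finite_subsets_at_top)
  \<comment> \<open>Adjoining one more index \<open>n\<close> to \<open>F\<close> leaves coefficient
    \<open>k\<close> of the partial sum unchanged.\<close>
  have "coeff_matrix (y n) k = 0" if "n \<in> T - F" for n
    using eq[of "insert n F"] eq[of F] F that by auto
  moreover have "coeff_matrix Y k = (\<Sum>n\<in>F. coeff_matrix (y n) k)"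
    using eq[of F] F by (simp add: coeff_matrix_sum)
  ultimately show thesis
    using that F by blast
qed

text \<open>No index contributes below exponent \<open>a\<close>, so up to \<open>K\<close> only the
  finite union of the \<open>F k\<close> over \<open>{a..K}\<close> matters; partial sums containing
  its part in \<open>T\<close> already have the right coefficients.\<close>

lemma has_sumI_coeff_matrix:
  fixes y :: "'i \<Rightarrow> ('f, 'n) lmat"
  assumes "\<And>k. finite (F k)"
    and "\<And>n k. n \<notin> F k \<Longrightarrow> coeff_matrix (y n) k = 0"
    and "\<And>k. k < a \<Longrightarrow> F k = {}"
    and "\<And>k. coeff_matrix Y k = (\<Sum>n\<in>F k \<inter> T. coeff_matrix (y n) k)"
  shows "(y has_sum Y) T"
  unfolding has_sum_def lmat_tendsto_iff
proof
  fix K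
  define G where "G = (\<Union>k\<in>{a..K}. F k) \<inter> T"
  have "finite G"
    using assms(1) by (auto simp: G_def)
  moreover have "coeff_matrix (sum y X) k = coeff_matrix Y k"
    if "finite X" "G \<subseteq> X" "X \<subseteq> T" "k \<le> K" for X k
  proof -
    have "F k \<inter> T \<subseteq> X"
    proof (cases "k < a")
      case False
      then have "F k \<inter> T \<subseteq> G"
        using that(4) by (auto simp: G_def intro!: bexI[of _ k])
      then show ?thesis
        using that(2) by blast
    qed (simp add: assms(3))
    then have "(\<Sum>n\<in>F k \<inter> T. coeff_matrix (y n) k) = (\<Sum>n\<in>X. coeff_matrix (y n) k)"
      using that assms(2)[of _ k] by (intro sum.mono_neutral_left) auto
    then show ?thesis
      by (simp add: assms(4) coeff_matrix_sum)
  qed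
  ultimately show "\<forall>\<^sub>F X in finite_subsets_at_top T. \<forall>k\<le>K. coeff_matrix (sum y X) k = coeff_matrix Y k"
    unfolding eventually_finite_subsets_at_top by (intro exI[of _ G] conjI allI impI) (auto simp: G_def)
qed

lemma weight_decomposition_unique:
  assumes x: "\<And>n. x n \<in> weight_space n k" "\<And>n. n \<notin> F \<Longrightarrow> x n = 0"
    and y: "\<And>n. y n \<in> weight_space n k" "\<And>n. n \<notin> G \<Longrightarrow> y n = 0"
    and "finite F" "finite G" and eq: "(\<Sum>n\<in>F. x n) = (\<Sum>n\<in>G. y n)"
  shows "x = y"
proof
  fix n
  let ?d = "\<lambda>n. x n + mscale (\<iota> (- 1)) (y n)"
  have d: "?d n = x n - y n" for n
    by (simp add: mscale_def vec_eq_iff \<iota>_minus)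
  have "(\<Sum>n\<in>F. x n) = (\<Sum>n\<in>F \<union> G. x n)"
    using assms by (intro sum.mono_neutral_left) auto
  moreover have "(\<Sum>n\<in>G. y n) = (\<Sum>n\<in>F \<union> G. y n)"
    using assms by (intro sum.mono_neutral_left) auto
  ultimately have "(\<Sum>n\<in>F \<union> G. ?d n) = 0"
    unfolding d using eq by (simp add: sum_subtractf)
  moreover have "?d n \<in> weight_space n k" for n
    using x y by (intro weight_space_add weight_space_mscale)
  ultimately have "?d n = 0" if "n \<in> F \<union> G"
    using weight_space_independent[of "F \<union> G" ?d k n] \<open>finite F\<close> \<open>finite G\<close> that by blast
  then show "x n = y n"
    unfolding d using x(2) y(2) by (cases "n \<in> F \<union> G") auto
qed

text \<open>At each exponent both sums are finite, which reduces the claim to independence of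
  eigenvectors. This is the uniqueness behind the \<open>THE\<close> in
  \<open>component\<close>.\<close>

lemma grade_has_sum_unique:
  assumes "\<And>n. y n \<in> grade \<iota> N H n" "\<And>n. z n \<in> grade \<iota> N H n" "(y has_sum Y) UNIV" "(z has_sum Y) UNIV"
  shows "y = z"
proof -
  have "(\<lambda>n. coeff_matrix (y n) k) = (\<lambda>n. coeff_matrix (z n) k)" for k
  proof -
    obtain F where F: "finite F" "\<And>n. n \<in> UNIV - F \<Longrightarrow> coeff_matrix (y n) k = 0"
      "coeff_matrix Y k = (\<Sum>n\<in>F. coeff_matrix (y n) k)"
      by (rule has_sum_coeff_matrix[OF assms(3), of k]) (rule that)
    obtain G where G: "finite G" "\<And>n. n \<in> UNIV - G \<Longrightarrow> coeff_matrix (z n) k = 0"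
      "coeff_matrix Y k = (\<Sum>n\<in>G. coeff_matrix (z n) k)"
      by (rule has_sum_coeff_matrix[OF assms(4), of k]) (rule that)
    show ?thesis
      by (rule weight_decomposition_unique[of _ k F _ G])
         (use assms(1,2) F(1,2) G(1,2) F(3)[symmetric] G(3)[symmetric] in \<open>simp_all add: grade_iff\<close>)
  qed
  then show ?thesis
    by (simp add: fun_eq_iff lmat_eq_iff)
qed

lemma component_eqI:
  "(\<And>n. y n \<in> grade \<iota> N H n) \<Longrightarrow> (y has_sum Y) UNIV \<Longrightarrow> component \<iota> N H Y = y"
  unfolding component_def by (rule the_equality) (auto intro: grade_has_sum_unique)

text \<open>The finite decompositions at all exponents are reassembled by grade. \<open>Z T\<close>
  collects the grades in \<open>T\<close>, so that \<open>Z {..<0}\<close> is the negative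
  part.\<close>

lemma graded_in_decompose:
  assumes R: "coefficient_ring R" and Y: "Y \<in> graded_in S R"
  obtains y Z where "\<And>n. y n \<in> grade \<iota> N H n" "\<And>T. (y has_sum Z T) T"
    "\<And>T. Z T \<in> graded_in (S \<inter> T) R" "\<And>T. Y = Z T + Z (- T)" "Y = Z UNIV"
proof -
  \<comment> \<open>The last clause forces the chosen grades to be empty where \<open>Y\<close>
    vanishes; the reassembled families are then bounded below in \<open>k\<close> and form Laurent
    series.\<close>
  define P where "P k F x \<longleftrightarrow> finite F \<and> F \<subseteq> S \<and> (\<forall>n. x n \<in> weight_space n k \<and> x n \<in> entries_in R)
      \<and> (\<forall>n. n \<notin> F \<longrightarrow> x n = 0) \<and> coeff_matrix Y k = (\<Sum>n\<in>F. x n) \<and> (coeff_matrix Y k = 0 \<longrightarrow> F = {})"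
    for k F x
  have "\<exists>F x. P k F x" for k
  proof (cases "coeff_matrix Y k = 0")
    case True
    then have "P k {} (\<lambda>_. 0)"
      by (simp add: P_def entries_in_def R_zero[OF R])
    then show ?thesis by blast
  next
    case False
    have "coeff_matrix Y k \<in> weight_sums S R k"
      using Y by (simp add: graded_in_def)
    then obtain F x where "finite F" "F \<subseteq> S" "\<And>n. x n \<in> weight_space n k" "\<And>n. x n \<in> entries_in R"
      "\<And>n. n \<notin> F \<Longrightarrow> x n = 0" "coeff_matrix Y k = (\<Sum>n\<in>F. x n)"
      by (rule weight_sums_decompose[OF R]) (rule that)
    with False have "P k F x"
      unfolding P_def by blast
    then show ?thesis by blast
  qed
  then obtain F x where P: "\<And>k. P k (F k) (x k)"
    by metis
  have F: "\<And>k. finite (F k)" "\<And>k. F k \<subseteq> S"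
    and x: "\<And>k n. x k n \<in> weight_space n k" "\<And>k n. x k n \<in> entries_in R"
    and x0: "\<And>k n. n \<notin> F k \<Longrightarrow> x k n = 0"
    and Yk: "\<And>k. coeff_matrix Y k = (\<Sum>n\<in>F k. x k n)" "\<And>k. coeff_matrix Y k = 0 \<Longrightarrow> F k = {}"
    using P unfolding P_def by blast+
  obtain a where "\<And>k. k < a \<Longrightarrow> coeff_matrix Y k = 0"
    by (rule coeff_matrix_lower_bound[of Y]) (rule that)
  then have Fa: "\<And>k. k < a \<Longrightarrow> F k = {}"
    using Yk(2) by blast
  define y where "y n = of_coeffs (\<lambda>k. x k n)" for n
  define Z where "Z T = of_coeffs (\<lambda>k. \<Sum>n\<in>F k \<inter> T. x k n)" for T
  have y: "coeff_matrix (y n) k = x k n" for n k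
    unfolding y_def by (rule coeff_matrix_of_coeffs[of a]) (use Fa x0 in blast)
  have Z: "coeff_matrix (Z T) k = (\<Sum>n\<in>F k \<inter> T. x k n)" for T k
    unfolding Z_def by (rule coeff_matrix_of_coeffs[of a]) (simp add: Fa)
  show thesis
  proof
    show "y n \<in> grade \<iota> N H n" for n
      by (simp add: grade_iff y x)
    show "(y has_sum Z T) T" for T
      by (rule has_sumI_coeff_matrix[of F _ a]) (auto simp: F Fa y Z x0)
    show "Z T \<in> graded_in (S \<inter> T) R" for T
    proof -
      have "x k n \<in> weight_sums (S \<inter> T) R k" if "n \<in> F k \<inter> T" for k n
        using that F(2)[of k] x by (intro weight_sums.weight[of n]) auto
      then have "coeff_matrix (Z T) k \<in> weight_sums (S \<inter> T) R k" for k
        unfolding Z by (rule weight_sums_sum)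
      then show ?thesis
        by (simp add: graded_in_def)
    qed
    show "Y = Z T + Z (- T)" for T
    proof -
      have "(\<Sum>n\<in>F k. x k n) = (\<Sum>n\<in>F k \<inter> T. x k n) + (\<Sum>n\<in>F k \<inter> - T. x k n)" for k
        using sum.Int_Diff[OF F(1), of "x k" k T] by (simp add: Diff_eq)
      then show ?thesis
        by (simp add: lmat_eq_iff Yk(1) Z)
    qed
    show "Y = Z UNIV"
      by (simp add: lmat_eq_iff Yk(1) Z)
  qed
qed

lemma negative_part_graded_in:
  assumes "coefficient_ring R" "Y \<in> graded_in S R"
  shows "negative_part \<iota> N H Y \<in> graded_in (S \<inter> {..<0}) R"
    and "Y - negative_part \<iota> N H Y \<in> graded_in (S \<inter> {0..}) R"
proof -
  obtain y Z where y: "\<And>n. y n \<in> grade \<iota> N H n" and Z: "\<And>T. (y has_sum Z T) T"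
    "\<And>T. Z T \<in> graded_in (S \<inter> T) R" and Y: "\<And>T. Y = Z T + Z (- T)" "Y = Z UNIV"
    by (rule graded_in_decompose[OF assms]) (rule that)
  have "(y has_sum Y) UNIV"
    using Y(2) Z(1)[of UNIV] by simp
  then have "component \<iota> N H Y = y"
    using y component_eqI by blast
  then have "negative_part \<iota> N H Y = Z {..<0}"
    unfolding negative_part_def using Z(1) infsumI by blast
  moreover have "- {..<0} = {0 :: int..}"
    by auto
  ultimately show "negative_part \<iota> N H Y \<in> graded_in (S \<inter> {..<0}) R"
    and "Y - negative_part \<iota> N H Y \<in> graded_in (S \<inter> {0..}) R"
    using Z(2)[of "{..<0}"] Z(2)[of "- {..<0}"] Y(1)[of "{..<0}"] by simp_all
qed

text \<open>At exponent 0 the weight is the grade itself, so components of nonzero grade are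
  traceless there.\<close>

lemma graded_trace_eq:
  assumes "coefficient_ring R" "Y \<in> graded_in S R"
  shows "graded_trace \<iota> N H Y = trace (coeff_matrix Y 0)"
proof -
  obtain y Z where y: "\<And>n. y n \<in> grade \<iota> N H n" and Z: "\<And>T. (y has_sum Z T) T"
    "\<And>T. Z T \<in> graded_in (S \<inter> T) R" and Y: "\<And>T. Y = Z T + Z (- T)" "Y = Z UNIV"
    by (rule graded_in_decompose[OF assms]) (rule that)
  have Ysum: "(y has_sum Y) UNIV"
    using Y(2) Z(1)[of UNIV] by simp
  obtain F where F: "finite F" "\<And>n. n \<in> UNIV - F \<Longrightarrow> coeff_matrix (y n) 0 = 0"
    "coeff_matrix Y 0 = (\<Sum>n\<in>F. coeff_matrix (y n) 0)"
    by (rule has_sum_coeff_matrix[OF Ysum, of 0]) (rule that)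
  have trace_sum: "trace (sum f F) = (\<Sum>i\<in>F. trace (f i))" for f :: "int \<Rightarrow> 'f^'n^'n" and F
    by (induction F rule: infinite_finite_induct) (simp_all add: trace_add trace_zero)
  have "trace (coeff_matrix Y 0) = (\<Sum>n\<in>F. trace (coeff_matrix (y n) 0))"
    by (simp add: F(3) trace_sum)
  also have "\<dots> = (\<Sum>n\<in>{0}. trace (coeff_matrix (y n) 0))"
  proof (rule sum.mono_neutral_cong)
    show "trace (coeff_matrix (y n) 0) = 0" if "n \<in> F - {0}" for n
      using that y[of n] weight_space_trace by (auto simp: grade_iff)
    show "trace (coeff_matrix (y n) 0) = 0" if "n \<in> {0} - F" for n
      using that F(2)[of n] by (auto simp: trace_zero)
  qed (use F(1) in auto)
  also have "\<dots> = graded_trace \<iota> N H Y"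
    using component_eqI[OF y Ysum] by (simp add: graded_trace_def trace_def fls_nth_sum)
  finally show ?thesis ..
qed

lemma graded_in_singleton: "Y \<in> graded_in {n} R \<Longrightarrow> Y \<in> grade \<iota> N H n"
proof -
  have "X \<in> weight_sums {n} R k \<Longrightarrow> X \<in> weight_space n k" for X k
    by (induction rule: weight_sums.induct) (auto intro: weight_space_add)
  then show "Y \<in> graded_in {n} R \<Longrightarrow> Y \<in> grade \<iota> N H n"
    by (simp add: grade_iff graded_in_def)
qed

text \<open>By uniqueness the decompositions along \<open>S\<close> and \<open>S'\<close> coincide,
  so only common grades occur. Used to pin an element of both nonnegative and nonpositive grades to
  grade 0.\<close>

lemma graded_in_Int:
  assumes Y: "Y \<in> graded_in S R" "Y \<in> graded_in S' R" and R: "coefficient_ring R"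
  shows "Y \<in> graded_in (S \<inter> S') R"
proof -
  have "X \<in> weight_sums (S \<inter> S') R k" if X: "X \<in> weight_sums S R k" "X \<in> weight_sums S' R k" for X k
  proof -
    obtain F x where F: "finite F" "F \<subseteq> S" "\<And>n. x n \<in> weight_space n k" "\<And>n. x n \<in> entries_in R"
      "\<And>n. n \<notin> F \<Longrightarrow> x n = 0" "X = (\<Sum>n\<in>F. x n)"
      by (rule weight_sums_decompose[OF R X(1)]) (rule that)
    obtain G y where G: "finite G" "G \<subseteq> S'" "\<And>n. y n \<in> weight_space n k" "\<And>n. y n \<in> entries_in R"
      "\<And>n. n \<notin> G \<Longrightarrow> y n = 0" "X = (\<Sum>n\<in>G. y n)"
      by (rule weight_sums_decompose[OF R X(2)]) (rule that)
    have eq: "x = y"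
      by (rule weight_decomposition_unique[of x k F y G]) (use F G in auto)
    have "X = (\<Sum>n\<in>F \<inter> G. x n)"
      unfolding F(6) using F(1) G(5) eq by (intro sum.mono_neutral_right) auto
    also have "\<dots> \<in> weight_sums (S \<inter> S') R k"
    proof (rule weight_sums_sum)
      show "x n \<in> weight_sums (S \<inter> S') R k" if "n \<in> F \<inter> G" for n
        using that F G by (intro weight_sums.weight[of n]) auto
    qed
    finally show ?thesis .
  qed
  with Y show ?thesis
    by (simp add: graded_in_def)
qed

end

section \<open>Series of loop matrices of decreasing grade\<close>

abbreviation matrix_power :: "'a::semiring_1^'n::finite^'n \<Rightarrow> nat \<Rightarrow> 'a^'n^'n" where
  "matrix_power Y k \<equiv> ((**) Y ^^ k) (mat 1)"

lemma matrix_power_commute: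
  "X ** Y = Y ** X \<Longrightarrow> X ** matrix_power Y k = matrix_power Y k ** X"
  by (induction k) (simp_all add: matrix_mul_assoc, metis matrix_mul_assoc)

lemma sums_commute:
  fixes Z :: "nat \<Rightarrow> ('f::comm_ring_1, 'n::finite) lmat"
  assumes "Z sums T" "\<And>k. X ** Z k = Z k ** X"
  shows "X ** T = T ** X"
proof -
  have lim: "(\<lambda>n. sum Z {..<n}) \<longlonglongrightarrow> T"
    using assms(1) by (simp add: sums_def)
  have "X ** sum Z {..<n} = sum Z {..<n} ** X" for n
    by (induction n) (simp_all add: matrix_ring_simps assms(2))
  then show ?thesis
    using LIMSEQ_unique[OF tendsto_matrix_mult(1)[OF lim, of X]] tendsto_matrix_mult(2)[OF lim, of X] by simp
qed

lemma infsum_commute: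
  fixes f :: "'i \<Rightarrow> ('f::comm_ring_1, 'n::finite) lmat"
  assumes "\<And>j. j \<in> T \<Longrightarrow> X ** f j = f j ** X"
  shows "X ** (\<Sum>\<^sub>\<infinity>j\<in>T. f j) = (\<Sum>\<^sub>\<infinity>j\<in>T. f j) ** X"
proof (cases "f summable_on T")
  case True
  then have lim: "(sum f \<longlongrightarrow> (\<Sum>\<^sub>\<infinity>j\<in>T. f j)) (finite_subsets_at_top T)"
    by (rule has_sum_infsum[unfolded has_sum_def])
  have comm: "X ** sum f F = sum f F ** X" if "finite F" "F \<subseteq> T" for F
    using that by (induction F rule: finite_induct) (simp_all add: matrix_ring_simps assms)
  have "\<forall>\<^sub>F F in finite_subsets_at_top T. X ** sum f F = sum f F ** X"
    by (rule eventually_finite_subsets_at_top_weakI) (rule comm)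
  with tendsto_matrix_mult(1)[OF lim, of X]
  have "((\<lambda>F. sum f F ** X) \<longlongrightarrow> X ** (\<Sum>\<^sub>\<infinity>j\<in>T. f j)) (finite_subsets_at_top T)"
    by (rule Lim_transform_eventually)
  then show ?thesis
    using tendsto_matrix_mult(2)[OF lim, of X] by (rule tendsto_unique[rotated]) simp
qed (simp add: infsum_not_exists)

context loop_gradation
begin

text \<open>Grades at most \<open>- j\<close> have weight at exponent \<open>k\<close> below
  \<open>- B\<close> once \<open>j > B + N k\<close>. Each exponent thus receives finitely many
  terms.\<close>

lemma graded_series_converges:
  assumes "\<And>j. Z j \<in> graded_in {..- int j} R"
  obtains T where "Z sums T"
proof -
  obtain B where B: "\<And>n k X. \<bar>of_int n + N * of_int k\<bar> > B \<Longrightarrow> X \<in> weight_space n k \<Longrightarrow> X = 0"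
    by (rule weight_space_bounded) (rule that)
  have zero_sums: "X = 0" if "X \<in> weight_sums {..- int j} R k" "B + N * of_int k < real j" for X j k
    using that
  proof (induction rule: weight_sums.induct)
    case (weight n X)
    then have "real_of_int n \<le> - real j"
      using of_int_le_iff[where ?'a = real, of n "- int j"] by simp
    with weight have "\<bar>of_int n + N * of_int k\<bar> > B"
      by linarith
    with B weight show ?case by blast
  qed auto
  have zero: "coeff_matrix (Z j) k = 0" if "B + N * of_int k < real j" for j k
  proof (rule zero_sums)
    show "coeff_matrix (Z j) k \<in> weight_sums {..- int j} R k"
      using assms[of j] by (simp add: graded_in_def)
  qed (rule that)
  define F where "F k = {j. real j \<le> B + N * of_int k}" for k :: int
  have "F k \<subseteq> {..nat \<lfloor>B + N * of_int k\<rfloor>}" for k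
    by (auto simp: F_def le_nat_floor)
  then have finF: "finite (F k)" for k
    by (rule finite_subset) simp
  \<comment> \<open>Below this exponent \<open>B + N k\<close> is negative, so not even
    \<open>j = 0\<close> contributes; the sum has only finitely many positive powers of
    \<open>\<lambda>\<close>.\<close>
  define a where "a = \<lfloor>- B / N\<rfloor>"
  have Fa: "F k = {}" if "k < a" for k
  proof -
    have "of_int k < - B / N"
      using that unfolding a_def by linarith
    then have "B + N * of_int k < 0"
      using N_pos by (simp add: field_simps)
    then show ?thesis
      by (auto simp: F_def)
  qed
  define T where "T = of_coeffs (\<lambda>k. \<Sum>j\<in>F k. coeff_matrix (Z j) k)"
  have "coeff_matrix T k = (\<Sum>j\<in>F k. coeff_matrix (Z j) k)" for k
    unfolding T_def by (rule coeff_matrix_of_coeffs[of a]) (simp add: Fa)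
  moreover have "coeff_matrix (Z j) k = 0" if "j \<notin> F k" for j k
    using that by (intro zero) (simp add: F_def)
  ultimately have "(Z has_sum T) UNIV"
    by (intro has_sumI_coeff_matrix[of F _ a]) (simp_all add: finF Fa)
  then show thesis
    using has_sum_imp_sums that by blast
qed

lemma sums_graded_in:
  assumes R: "coefficient_ring R" and "Z sums T" "\<And>j. j \<ge> m \<Longrightarrow> Z j \<in> graded_in S R"
  shows "T - sum Z {..<m} \<in> graded_in S R"
proof (rule graded_in_tendsto)
  have "(\<lambda>n. sum Z {..<n}) \<longlonglongrightarrow> T"
    using assms(2) by (simp add: sums_def)
  \<comment> \<open>Subtracting a limit from a constant twice amounts to subtracting a constant from
    it.\<close>
  then have "(\<lambda>n. - (sum Z {..<m} - sum Z {..<n})) \<longlonglongrightarrow> - (sum Z {..<m} - T)"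
    using tendsto_lmat_diff[OF tendsto_lmat_diff, of _ _ sequentially 0 "sum Z {..<m}"] by simp
  then show "(\<lambda>n. sum Z {..<n} - sum Z {..<m}) \<longlonglongrightarrow> T - sum Z {..<m}"
    by simp
  have "sum Z {..<n} - sum Z {..<m} \<in> graded_in S R" if "m \<le> n" for n
  proof -
    have "sum Z {..<n} - sum Z {..<m} = sum Z ({..<n} - {..<m})"
      using that by (intro sum_diff[symmetric]) auto
    then show ?thesis
      using assms(3) by (auto intro: graded_in_sum)
  qed
  then show "\<forall>\<^sub>F n in sequentially. sum Z {..<n} - sum Z {..<m} \<in> graded_in S R"
    unfolding eventually_sequentially by blast
qed simp

section \<open>Inverses and exponentials of series in negative grades\<close>

lemma matrix_power_graded_in:
  assumes "coefficient_ring R" "Y \<in> graded_in {..-1} R"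
  shows "matrix_power Y k \<in> graded_in {..- int k} R"
proof (induction k)
  case 0
  show ?case
    using assms(1) by (simp add: graded_in_mat_one)
next
  case (Suc k)
  show ?case
    using graded_in_mult[OF assms(1) _ assms(2) Suc, of "{..- int (Suc k)}"] by simp
qed

text \<open>The inverse is the geometric series in \<open>- V\<close>. The products with partial
  sums telescope to \<open>mat 1 - ?Z n\<close>, and \<open>?Z n\<close> tends to 0 as the
  difference of consecutive partial sums. The left inverse follows because the series commutes with
  \<open>mat 1 + V\<close>.\<close>

lemma neumann_inverse:
  assumes R: "coefficient_ring R" and V: "V \<in> graded_in {..-1} R"
  obtains T where "T \<in> graded_in {..0} R" "(mat 1 + V) ** T = mat 1" "T ** (mat 1 + V) = mat 1"
proof -
  let ?Z = "matrix_power (- V)"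
  have Z: "?Z j \<in> graded_in {..- int j} R" for j
    using matrix_power_graded_in[OF R graded_in_minus[OF R V]] .
  obtain T where T: "?Z sums T"
    by (rule graded_series_converges[OF Z]) (rule that)
  have "T - sum ?Z {..<0} \<in> graded_in {..0} R"
    by (intro sums_graded_in[OF R T] graded_in_mono[OF Z]) auto
  then have T0: "T \<in> graded_in {..0} R"
    by simp
  have lim: "(\<lambda>n. sum ?Z {..<n}) \<longlonglongrightarrow> T"
    using T by (simp add: sums_def)
  have telescope: "(mat 1 + V) ** sum ?Z {..<n} = mat 1 - ?Z n" for n
    by (induction n) (simp_all add: matrix_ring_simps)
  have "?Z \<longlonglongrightarrow> 0"
    unfolding lmat_tendsto_iff
  proof
    fix K
    have "\<forall>\<^sub>F n in sequentially. \<forall>k\<le>K. coeff_matrix (sum ?Z {..<n}) k = coeff_matrix T k"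
      using lim[unfolded lmat_tendsto_iff] by (rule spec)
    then obtain n0 where n0: "\<And>n k. n \<ge> n0 \<Longrightarrow> k \<le> K \<Longrightarrow> coeff_matrix (sum ?Z {..<n}) k = coeff_matrix T k"
      unfolding eventually_sequentially by blast
    have "coeff_matrix (?Z n) k = 0" if "n \<ge> n0" "k \<le> K" for n k
      using n0[of n k] n0[of "Suc n" k] that by simp
    then show "\<forall>\<^sub>F n in sequentially. \<forall>k\<le>K. coeff_matrix (?Z n) k = coeff_matrix 0 k"
      unfolding eventually_sequentially by auto
  qed
  then have "(\<lambda>n. mat 1 - ?Z n) \<longlonglongrightarrow> mat 1 - 0"
    by (rule tendsto_lmat_diff)
  moreover have "(\<lambda>n. mat 1 - ?Z n) \<longlonglongrightarrow> (mat 1 + V) ** T"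
    using tendsto_matrix_mult(1)[OF lim, of "mat 1 + V"] by (simp add: telescope)
  ultimately have inv: "(mat 1 + V) ** T = mat 1"
    using LIMSEQ_unique by fastforce
  have "(mat 1 + V) ** ?Z k = ?Z k ** (mat 1 + V)" for k
    by (rule matrix_power_commute) (simp add: matrix_ring_simps)
  then have "T ** (mat 1 + V) = mat 1"
    using sums_commute[OF T] inv by simp
  with T0 inv show thesis by (rule that)
qed

text \<open>Removing the term \<open>k = 0\<close>, the identity, leaves grades at most -1, so the
  geometric series inverts the exponential without leaving \<open>R\<close>. For \<open>R\<close>
  the local expressions this makes \<open>U\<close> and its inverse local.\<close>

lemma mexp_graded:
  assumes R: "coefficient_ring R" and Y: "Y \<in> graded_in {..-1} R"
  shows "mexp \<iota> Y \<in> graded_in {..0} R"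
    and "matrix_inv (mexp \<iota> Y) \<in> graded_in {..0} R"
    and "mexp \<iota> Y ** matrix_inv (mexp \<iota> Y) = mat 1"
    and "matrix_inv (mexp \<iota> Y) ** mexp \<iota> Y = mat 1"
    and "X ** Y = Y ** X \<Longrightarrow> X ** mexp \<iota> Y = mexp \<iota> Y ** X"
proof -
  define Z where "Z k = mscale (fls_const (\<iota> (1 / fact k))) (matrix_power Y k)" for k
  have Z: "Z j \<in> graded_in {..- int j} R" for j
    unfolding Z_def by (intro graded_in_mscale R matrix_power_graded_in Y)
  obtain T where T: "Z sums T"
    by (rule graded_series_converges[OF Z]) (rule that)
  have exp: "mexp \<iota> Y = T"
    unfolding mexp_def Z_def[symmetric] using T by (rule sums_unique[symmetric])
  have "T - sum Z {..<Suc 0} \<in> graded_in {..-1} R"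
    by (intro sums_graded_in[OF R T] graded_in_mono[OF Z]) auto
  moreover have "Z 0 = mat 1"
    by (simp add: Z_def)
  ultimately have V: "T - mat 1 \<in> graded_in {..-1} R"
    by simp
  obtain T' where T': "T' \<in> graded_in {..0} R" "T ** T' = mat 1" "T' ** T = mat 1"
    by (rule neumann_inverse[OF R V]) (use that in simp)
  have "mat 1 + (T - mat 1) \<in> graded_in {..0} R"
    by (intro graded_in_add graded_in_mat_one R graded_in_mono[OF V]) auto
  then show "mexp \<iota> Y \<in> graded_in {..0} R"
    by (simp add: exp)
  have "matrix_inv T = T'"
    using T'(2,3) by (rule matrix_inv_eqI)
  then show "matrix_inv (mexp \<iota> Y) \<in> graded_in {..0} R"
    and "mexp \<iota> Y ** matrix_inv (mexp \<iota> Y) = mat 1"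
    and "matrix_inv (mexp \<iota> Y) ** mexp \<iota> Y = mat 1"
    using T' by (simp_all add: exp)
  show "X ** mexp \<iota> Y = mexp \<iota> Y ** X" if "X ** Y = Y ** X"
    unfolding exp
  proof (rule sums_commute[OF T])
    show "X ** Z k = Z k ** X" for k
      using matrix_power_commute[OF that, of k] by (simp add: Z_def mscale_mult_left mscale_mult_right)
  qed
qed

section \<open>Derivations\<close>

lemma adQ_add: "adQ \<iota> N H (X + Y) = adQ \<iota> N H X + adQ \<iota> N H Y"
  by (simp add: lmat_eq_iff coeff_matrix_adQ lie_add_right mscale_add)

lemma adQ_mult: "adQ \<iota> N H (X ** Y) = adQ \<iota> N H X ** Y + X ** adQ \<iota> N H Y"
proof -
  have deriv: "map_matrix (\<lambda>f. c * fls_X * fls_deriv f) (X ** Y)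
      = map_matrix (\<lambda>f. c * fls_X * fls_deriv f) X ** Y + X ** map_matrix (\<lambda>f. c * fls_X * fls_deriv f) Y"
    for c :: "'f fls"
  proof -
    have deriv_sum: "fls_deriv (sum g F) = (\<Sum>i\<in>F. fls_deriv (g i))" for g :: "'n \<Rightarrow> 'f fls" and F
      by (induction F rule: infinite_finite_induct) simp_all
    show ?thesis
      by (simp add: vec_eq_iff matrix_matrix_mult_def deriv_sum sum_distrib_left
          flip: sum.distrib) (simp add: algebra_simps)
  qed
  show ?thesis
    unfolding adQ_def lie_mult_right deriv matrix_add_ldistrib matrix_add_rdistrib by simp
qed

lemma adQ_minus: "adQ \<iota> N H (- X) = - adQ \<iota> N H X"
  using adQ_add[of X "- X"] adQ_add[of 0 0] by (simp add: eq_neg_iff_add_eq_0 add.commute)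

lemma adQ_lie: "adQ \<iota> N H (lie X Y) = lie (adQ \<iota> N H X) Y + lie X (adQ \<iota> N H Y)"
  using adQ_add[of "X ** Y" "- (Y ** X)"] by (simp add: lie_def adQ_minus adQ_mult algebra_simps)

lemma adQ_graded_in:
  assumes R: "coefficient_ring R" and Y: "Y \<in> graded_in S R"
  shows "adQ \<iota> N H Y \<in> graded_in S R"
proof -
  have "lie H\<iota> X - mscale (\<iota> (of_real (N * of_int k))) X \<in> weight_sums S R k" if "X \<in> weight_sums S R k" for X k
    using that
  proof (induction rule: weight_sums.induct)
    case (weight n X)
    then have "lie H\<iota> X - mscale (\<iota> (of_real (N * of_int k))) X = mscale (\<iota> (of_int n)) X"
      by (simp add: weight_space_def weight_def flip: mscale_diff_left \<iota>_diff)
    then show ?case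
      using weight weight_sums_mscale[OF R] weight_sums.weight by simp
  next
    case (add X Y)
    then show ?case
      using weight_sums.add[OF add.IH] by (simp add: lie_add_right mscale_add algebra_simps)
  qed (simp add: weight_sums.zero)
  with Y show ?thesis
    by (simp add: graded_in_def coeff_matrix_adQ)
qed

lemma adQ_grade: "Y \<in> grade \<iota> N H n \<Longrightarrow> adQ \<iota> N H Y = mscale (of_int n) Y"
  by (simp add: grade_def)

section \<open>Coefficientwise extension of a derivation\<close>

context
  fixes d assumes d: "derivation \<iota> d"
begin

lemma d_add: "d (f + g) = d f + d g" and d_mult: "d (f * g) = d f * g + f * d g" and d_\<iota> [simp]: "d (\<iota> c) = 0"
  using d by (simp_all add: derivation_def)

lemma d_zero [simp]: "d 0 = 0"
  using d_add[of 0 0] by simp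

lemma d_minus: "d (- f) = - d f"
  using d_add[of f "- f"] by (simp add: eq_neg_iff_add_eq_0 add.commute)

lemma d_sum: "d (sum f F) = (\<Sum>i\<in>F. d (f i))"
  by (induction F rule: infinite_finite_induct) (simp_all add: d_add)

lemma d_matrix_mult: "map_matrix d (X ** Y) = map_matrix d X ** Y + X ** map_matrix d Y"
  by (simp add: vec_eq_iff matrix_matrix_mult_def d_sum d_mult sum.distrib)

lemma d_matrix_\<iota>: "map_matrix d (mscale (\<iota> c) X) = mscale (\<iota> c) (map_matrix d X)"
  by (simp add: vec_eq_iff mscale_def d_mult)

lemma d_trace: "d (trace X) = trace (map_matrix d X)"
  by (simp add: trace_def d_sum)

lemma d_lie: "map_matrix d (lie H\<iota> X) = lie H\<iota> (map_matrix d X)"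
proof -
  have "map_matrix d H\<iota> = 0" "map_matrix d (X - Y) = map_matrix d X - map_matrix d Y" for X Y :: "'f^'n^'n"
    using d_add[of _ "- _"] by (simp_all add: vec_eq_iff d_minus)
  then show ?thesis
    by (simp add: lie_def d_matrix_mult)
qed

lemma coeff_matrix_d [simp]: "coeff_matrix (coeffwise d Y) k = map_matrix d (coeff_matrix Y k)"
  by (simp add: coeff_matrix_coeffwise)

lemma coeffwise_d_add: "coeffwise d (X + Y) = coeffwise d X + coeffwise d Y"
  by (simp add: lmat_eq_iff) (simp add: vec_eq_iff d_add)

lemma coeffwise_d_mult:
  fixes X Y :: "('f, 'n) lmat"
  shows "coeffwise d (X ** Y) = coeffwise d X ** Y + X ** coeffwise d Y"
proof -
  obtain a where X: "\<And>k. k < a \<Longrightarrow> coeff_matrix X k = 0"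
    by (rule coeff_matrix_lower_bound[of X]) (rule that)
  obtain b where Y: "\<And>k. k < b \<Longrightarrow> coeff_matrix Y k = 0"
    by (rule coeff_matrix_lower_bound[of Y]) (rule that)
  have d0: "map_matrix d 0 = (0 :: 'f^'n^'n)"
    by (simp add: vec_eq_iff)
  have dX: "\<And>k. k < a \<Longrightarrow> coeff_matrix (coeffwise d X) k = 0"
    and dY: "\<And>k. k < b \<Longrightarrow> coeff_matrix (coeffwise d Y) k = 0"
    using X Y by (simp_all add: d0)
  have map_sum: "map_matrix d (sum g F) = (\<Sum>i\<in>F. map_matrix d (g i))" for g :: "int \<Rightarrow> 'f^'n^'n" and F
    by (induction F rule: infinite_finite_induct) (simp_all add: d0, simp add: vec_eq_iff d_add)
  show ?thesis
    by (simp add: lmat_eq_iff coeff_matrix_mult[OF X Y] coeff_matrix_mult[OF dX Y]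
        coeff_matrix_mult[OF X dY] map_sum d_matrix_mult sum.distrib)
qed

lemma coeffwise_d_mat_one [simp]: "coeffwise d (mat 1 :: ('f, 'n) lmat) = 0"
  using coeffwise_d_mult[of "mat 1" "mat 1"] by simp

lemma coeffwise_d_constants: "Y \<in> constants \<iota> \<Longrightarrow> coeffwise d Y = 0"
  by (auto simp: constants_def lmat_eq_iff coeff_matrix_coeffwise) (simp add: vec_eq_iff)

lemma coeffwise_d_adQ: "coeffwise d (adQ \<iota> N H Y) = adQ \<iota> N H (coeffwise d Y)"
proof -
  have "map_matrix d (X - Y) = map_matrix d X - map_matrix d Y" for X Y :: "'f^'n^'n"
    using d_add[of _ "- _"] by (simp add: vec_eq_iff d_minus)
  then show ?thesis
    by (simp add: lmat_eq_iff coeff_matrix_adQ d_lie d_matrix_\<iota>)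
qed

text \<open>The entries of \<open>H\<close> are constant, so \<open>d\<close> preserves every
  eigenspace of \<open>ad H\<close>. Coefficients are taken in \<open>UNIV\<close> because
  \<open>R\<close> is not assumed closed under \<open>d\<close>.\<close>

lemma coeffwise_d_graded_in:
  assumes "Y \<in> graded_in S UNIV"
  shows "coeffwise d Y \<in> graded_in S UNIV"
proof -
  have "map_matrix d X \<in> weight_sums S UNIV k" if "X \<in> weight_sums S UNIV k" for X k
    using that
  proof (induction rule: weight_sums.induct)
    case zero
    then show ?case
      using weight_sums.zero by (simp add: map_matrix_def zero_vec_def)
  next
    case (weight n X)
    then have "map_matrix d X \<in> weight_space n k"
      by (simp add: weight_space_def d_matrix_\<iota> flip: d_lie)
    with weight show ?case
      by (intro weight_sums.weight[of n]) (simp_all add: entries_in_def)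
  next
    case (add X Y)
    have "map_matrix d (X + Y) = map_matrix d X + map_matrix d Y"
      by (simp add: vec_eq_iff d_add)
    with add show ?case
      by (simp add: weight_sums.add)
  qed
  with assms show ?thesis
    by (simp add: graded_in_def)
qed

text \<open>For \<open>\<partial>\<^sub>x\<close> one has \<open>P = - (E + A)\<close> and \<open>e = E\<close>, for the flow of \<open>b\<^sub>m\<close>
  \<open>P = (\<Theta> b\<^sub>m \<Theta>')\<^sub>-\<close> and \<open>e = 0\<close>.\<close>

lemma derivative_dressed:
  fixes \<Theta> :: "('f, 'n) lmat"
  assumes inv: "\<Theta> ** \<Theta>' = mat 1" "\<Theta>' ** \<Theta> = mat 1" and dc: "coeffwise d c = 0"
    and d\<Theta>: "coeffwise d \<Theta> = P ** \<Theta> + \<Theta> ** e" and comm: "lie e c = 0"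
  shows "coeffwise d (\<Theta> ** c ** \<Theta>') = lie P (\<Theta> ** c ** \<Theta>')"
proof -
  let ?W = "\<Theta> ** c ** \<Theta>'"
  \<comment> \<open>Differentiating \<open>\<Theta> ** \<Theta>' = mat 1\<close> gives the
    derivative of the inverse.\<close>
  have "coeffwise d \<Theta> ** \<Theta>' + \<Theta> ** coeffwise d \<Theta>' = 0"
    using coeffwise_d_mult[of \<Theta> \<Theta>'] inv by simp
  then have "\<Theta>' ** (\<Theta> ** coeffwise d \<Theta>') = - (\<Theta>' ** (coeffwise d \<Theta> ** \<Theta>'))"
    by (simp add: add_eq_0_iff matrix_minus_right)
  then have d\<Theta>': "coeffwise d \<Theta>' = - (\<Theta>' ** coeffwise d \<Theta> ** \<Theta>')"
    by (simp add: matrix_mul_assoc inv)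
  have "\<Theta>' ** P ** \<Theta> ** \<Theta>' = \<Theta>' ** P" "\<Theta>' ** \<Theta> ** e = e"
    using inv by (simp_all flip: matrix_mul_assoc)
  \<comment> \<open>The terms with \<open>e\<close> combine to the dressed commutator of
    \<open>e\<close> and \<open>c\<close>, which \<open>comm\<close> kills.\<close>
  then have "coeffwise d ?W = P ** ?W - ?W ** P + \<Theta> ** (e ** c - c ** e) ** \<Theta>'"
    using inv by (simp add: coeffwise_d_mult dc d\<Theta>' d\<Theta> matrix_ring_simps)
  then show ?thesis
    using comm by (simp add: lie_def)
qed

end

end

section \<open>Conservation of the Hamiltonians\<close>

lemma lie_minus_left: "lie (- X) Y = - lie X Y"
  by (simp add: lie_def matrix_ring_simps)

lemma trace_coeff_commute:
  fixes X Y :: "('f::comm_ring_1, 'n::finite) lmat"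
  shows "trace (coeff_matrix (X ** Y) k) = trace (coeff_matrix (Y ** X) k)"
proof -
  have "trace (coeff_matrix Z k) = fls_nth (trace Z) k" for Z :: "('f, 'n) lmat"
    by (simp add: trace_def fls_nth_sum)
  then show ?thesis
    by (simp add: trace_mul_sym[of X Y])
qed

lemma trace_coeff_lie: "trace (coeff_matrix (lie X Y) k) = 0"
  for X Y :: "('f::comm_ring_1, 'n::finite) lmat"
  by (simp add: lie_def trace_sub trace_coeff_commute[of X Y])

context loop_gradation
begin

lemma lie_graded_in:
  assumes "coefficient_ring R" "X \<in> graded_in S R" "Y \<in> graded_in S' R"
    and "\<And>n m. n \<in> S \<Longrightarrow> m \<in> S' \<Longrightarrow> n + m \<in> S''"
  shows "lie X Y \<in> graded_in S'' R"
proof -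
  have "\<And>m n. m \<in> S' \<Longrightarrow> n \<in> S \<Longrightarrow> m + n \<in> S''"
    by (subst add.commute) (rule assms(4))
  then show ?thesis
    unfolding lie_def using assms by (intro graded_in_diff graded_in_mult[where S'' = S'']) auto
qed

text \<open>With \<open>P\<^sub>+ = P - P\<^sub>-\<close>, the current is \<open>Tr ([Q, P\<^sub>+] W)\<close>: the operator \<open>\<partial>\<^sub>x + [E + A, _]\<close> sends
  \<open>P\<^sub>+\<close> to grades \<open>\<ge> 0\<close> and \<open>- P\<^sub>-\<close> to grades \<open>\<le> 0\<close>; the two images coincide, hence have grade 0 and
  are annihilated by \<open>[Q, _]\<close>.\<close>

lemma density_flow_is_x_derivative:
  assumes R: "coefficient_ring R" and dx: "derivation \<iota> dx" and dt: "derivation \<iota> dt"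
    and E: "E \<in> grade \<iota> N H 1" "coeffwise dt E = 0" and A: "A \<in> grade \<iota> N H 0"
    and P: "P \<in> graded_in UNIV R" and W: "W \<in> graded_in UNIV R"
    and dxP: "coeffwise dx P = - lie (E + A) P" and dxW: "coeffwise dx W = - lie (E + A) W"
    and dtW: "coeffwise dt W = lie (negative_part \<iota> N H P) W" and comm: "lie P W = 0"
  shows "\<exists>J\<in>R. dt (trace (coeff_matrix (E ** W) 0)) = dx J"
proof -
  define Pm where "Pm = negative_part \<iota> N H P"
  define Pp where "Pp = P - Pm"
  have Pm: "Pm \<in> graded_in {..<0} R" and Pp: "Pp \<in> graded_in {0..} R"
    using negative_part_graded_in[OF R P] by (simp_all add: Pm_def Pp_def)
  have P_split: "P = Pp + Pm"
    by (simp add: Pp_def)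
  \<comment> \<open>The image of \<open>Pp\<close> under the operator; by \<open>dxP\<close> it is
    minus the image of \<open>Pm\<close>, which bounds its grades from the other side.\<close>
  define Z where "Z = coeffwise dx Pp + lie (E + A) Pp"
  have "E \<in> graded_in {1} UNIV" "A \<in> graded_in {0} UNIV"
    using E(1) A by (auto intro: graded_in_grade)
  then have EA: "E + A \<in> graded_in {0, 1} UNIV"
    by (intro graded_in_add) (auto elim: graded_in_mono)
  have Pm': "Pm \<in> graded_in {..<0} UNIV" and Pp': "Pp \<in> graded_in {0..} UNIV"
    using Pm Pp by (auto elim: graded_in_mono)
  have "Z = - (coeffwise dx Pm + lie (E + A) Pm)"
    using dxP by (simp add: Z_def P_split coeffwise_d_add[OF dx] lie_add_right algebra_simps eq_neg_iff_add_eq_0)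
  also have "\<dots> \<in> graded_in {..0} UNIV"
  proof (intro graded_in_minus graded_in_add coefficient_ring_UNIV)
    show "coeffwise dx Pm \<in> graded_in {..0} UNIV"
      using coeffwise_d_graded_in[OF dx Pm'] by (rule graded_in_mono) auto
    show "lie (E + A) Pm \<in> graded_in {..0} UNIV"
      by (rule lie_graded_in[OF coefficient_ring_UNIV EA Pm']) auto
  qed
  finally have "Z \<in> graded_in {..0} UNIV" .
  moreover have "Z \<in> graded_in {0..} UNIV"
    unfolding Z_def
  proof (intro graded_in_add)
    show "coeffwise dx Pp \<in> graded_in {0..} UNIV"
      using coeffwise_d_graded_in[OF dx Pp'] .
    show "lie (E + A) Pp \<in> graded_in {0..} UNIV"
      by (rule lie_graded_in[OF coefficient_ring_UNIV EA Pp']) auto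
  qed
  ultimately have "Z \<in> graded_in ({..0} \<inter> {0..}) UNIV"
    by (intro graded_in_Int) auto
  moreover have "{..0} \<inter> {0..} = {0 :: int}"
    by auto
  ultimately have "Z \<in> grade \<iota> N H 0"
    by (metis graded_in_singleton)
  then have "adQ \<iota> N H Z = 0"
    by (simp add: adQ_grade mscale_def vec_eq_iff)
  \<comment> \<open>Only \<open>E\<close> survives, having grade 1 while \<open>A\<close> has grade
    0. This is how the \<open>E\<close> of the density enters the derivative of the current.\<close>
  moreover have adQ_EA: "adQ \<iota> N H (E + A) = E"
    using E(1) A by (simp add: adQ_add adQ_grade) (simp add: mscale_def vec_eq_iff)
  ultimately have adQ_dx: "adQ \<iota> N H (coeffwise dx Pp) = - lie E Pp - lie (E + A) (adQ \<iota> N H Pp)"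
    by (simp add: Z_def adQ_add adQ_lie algebra_simps eq_neg_iff_add_eq_0)
  define Q where "Q = adQ \<iota> N H Pp"
  define J where "J = trace (coeff_matrix (Q ** W) 0)"
  have "Q ** W \<in> graded_in UNIV R"
    unfolding Q_def by (rule graded_in_mult[OF R _ adQ_graded_in[OF R Pp] W]) auto
  then have "J \<in> R"
    unfolding J_def trace_def coeff_matrix_nth by (intro R_sum[OF R] graded_in_entries[OF R])
  have "dx J = trace (coeff_matrix (coeffwise dx (Q ** W)) 0)"
    by (simp add: J_def d_trace[OF dx] coeff_matrix_d[OF dx])
  \<comment> \<open>The last term is a commutator, hence traceless at every exponent.\<close>
  also have "coeffwise dx (Q ** W) = - (lie E Pp ** W) - lie (E + A) (Q ** W)"
    unfolding coeffwise_d_mult[OF dx] dxW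
    by (simp add: Q_def coeffwise_d_adQ[OF dx] adQ_dx lie_mult_right matrix_ring_simps)
  also have "trace (coeff_matrix \<dots> 0) = trace (coeff_matrix (- (lie E Pp ** W)) 0)"
    by (simp add: trace_sub trace_coeff_lie)
  \<comment> \<open>Cyclicity moves the commutator from \<open>E\<close> onto
    \<open>W\<close>.\<close>
  also have "\<dots> = trace (coeff_matrix (- (E ** lie Pp W)) 0)"
    using trace_coeff_lie[of Pp "E ** W"] trace_coeff_lie[of E "Pp ** W"]
    by (simp add: lie_def matrix_ring_simps trace_sub trace_minus)
  \<comment> \<open>\<open>W\<close> commutes with \<open>P\<close>, so \<open>Pp\<close> may be
    traded for \<open>- Pm\<close>, which generates the flow.\<close>
  also have "lie Pp W = - lie Pm W"
    using comm by (simp add: P_split lie_add_left eq_neg_iff_add_eq_0)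
  also have "trace (coeff_matrix (- (E ** - lie Pm W)) 0) = dt (trace (coeff_matrix (E ** W) 0))"
    by (simp add: d_trace[OF dt] coeff_matrix_d[OF dt, symmetric] coeffwise_d_mult[OF dt] E(2) dtW
        matrix_minus_right flip: Pm_def)
  finally show ?thesis
    using \<open>J \<in> R\<close> by metis
qed

end

theorem corollary3p2:
  fixes \<gg> :: "(complex^'n^'n::finite) set"
    and \<sigma> :: "complex^'n^'n \<Rightarrow> complex^'n^'n" and r :: nat
    and N :: real and H :: "complex^'n^'n"
    and E0 :: "(complex, 'n) lmat"
    and \<iota> :: "complex \<Rightarrow> 'f::comm_ring_1"
    and dx :: "'f \<Rightarrow> 'f" and dt :: "nat \<Rightarrow> 'f \<Rightarrow> 'f"
    and A Kminus E U S \<Theta> :: "('f, 'n) lmat"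
    and G K M :: "('f, 'n) lmat set" and gr :: "int \<Rightarrow> ('f, 'n) lmat set"
    and Loc :: "'f set" and flows :: "nat set"
    and u s b :: "nat \<Rightarrow> ('f, 'n) lmat"
    and I :: "'f \<Rightarrow> 'v::ab_group_add" and dI :: "nat \<Rightarrow> 'v \<Rightarrow> 'v"
  assumes "G = affine_algebra \<iota> \<gg> \<sigma> r"
    and "gr = grade \<iota> N H"
    and "E = coeffwise \<iota> E0"
    and "K = ker_ad G E"
    and "M = im_ad G E"
    and "Loc = local_expressions \<iota> dx A"
    and "U = mexp \<iota> (\<Sum>\<^sub>\<infinity>j\<in>{1..}. u j)"
    and "S = mexp \<iota> (\<Sum>\<^sub>\<infinity>j\<in>{1..}. s j)"
    and "\<Theta> = U ** S"
    and "flows = flow_indices \<iota> N H K"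
    and "simple_lie_algebra \<gg>" and "finite_order_automorphism \<gg> \<sigma> r"
    and "integral_gradation \<gg> \<sigma> r N H"
    and "E0 \<in> affine_algebra id \<gg> \<sigma> r \<inter> grade id N H 1"
    and "ad_semisimple (affine_algebra id \<gg> \<sigma> r) E0"
    and "complex_algebra \<iota>" and "derivation \<iota> dx"
    and "A \<in> M \<inter> gr 0"
    and "\<And>j. j \<ge> 1 \<Longrightarrow> u j \<in> M \<inter> gr (- int j)"
    and "\<And>j p q k. j \<ge> 1 \<Longrightarrow> fls_nth (u j $ p $ q) k \<in> Loc"
    and "Kminus \<in> negative_completion \<iota> N H K"
    and "conjugate_operator U (lax_operator dx (E + A)) = lax_operator dx (E + Kminus)"
    and "\<And>j. j \<ge> 1 \<Longrightarrow> s j \<in> K \<inter> gr (- int j)"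
    and "conjugate_operator S (lax_operator dx (E + Kminus)) = lax_operator dx E"
    and "\<And>m. m \<in> flows \<Longrightarrow> b m \<in> constants \<iota> \<inter> center K \<inter> gr (int m)"
    and "b 1 = E"
    and "\<And>m. m \<in> flows \<Longrightarrow> isospectral_flow \<iota> N H \<Theta> (b m) (dt m)"
    and "dt 1 = dx"
    and "integration Loc dx flows dt dI I"
  shows "\<forall>m \<in> flows. \<forall>n>0. \<forall>c \<in> constants \<iota> \<inter> center K \<inter> gr (int n).
           dI m (I (hamiltonian_density \<iota> N H E U c)) = 0"
proof -
  interpret loop_gradation \<iota> N H
    using assms(13,16) by unfold_locales (simp_all add: integral_gradation_def)
  \<comment> \<open>\<open>E0\<close> has complex entries, so its grade is expressed in the instance
    \<open>id\<close> and then carried along the ring homomorphism \<open>\<iota>\<close>.\<close>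
  interpret complex: loop_gradation id N H
    using N_pos by unfold_locales (simp_all add: complex_algebra_def)
  note dx = \<open>derivation \<iota> dx\<close>
  have R: "coefficient_ring Loc"
    unfolding coefficient_ring_def assms(6) by (auto intro: local_expressions.intros)
  have \<iota>_Loc: "\<iota> a \<in> Loc" for a
    using R by (auto simp: coefficient_ring_def)

  have lie_\<iota>: "lie H\<iota> (map_matrix \<iota> X) = map_matrix \<iota> (lie H X)" for X
    by (simp add: lie_def vec_eq_iff matrix_matrix_mult_def \<iota>_diff \<iota>_sum \<iota>_mult)
  have "map_matrix id H = H"
    by (simp add: vec_eq_iff)
  then have "E \<in> grade \<iota> N H 1"
    using assms(14) unfolding assms(3)
    by (simp add: grade_iff complex.grade_iff weight_space_def complex.weight_space_def weight_def
        complex.weight_def coeff_matrix_coeffwise lie_\<iota>) (simp add: mscale_def vec_eq_iff \<iota>_mult)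
  moreover have constants_Loc: "fls_nth (Y $ i $ j) k \<in> Loc" if Y: "Y \<in> constants \<iota>" for Y :: "('f, 'n) lmat" and i j k
  proof -
    obtain C where "Y = coeffwise \<iota> C"
      using Y by (auto simp: constants_def)
    then have "coeff_matrix Y k $ i $ j = \<iota> (coeff_matrix C k $ i $ j)"
      by (simp only: coeff_matrix_coeffwise[of \<iota>, OF \<iota>_zero] nth_map_matrix)
    then show ?thesis
      using \<iota>_Loc by simp
  qed
  moreover have E_const: "E \<in> constants \<iota>"
    using assms(3) by (simp add: constants_def)
  ultimately have E: "E \<in> grade \<iota> N H 1" "E \<in> graded_in {1} Loc"
    by (auto intro: graded_in_grade)
  have A: "A \<in> grade \<iota> N H 0"
    using assms(2,18) by simp

  \<comment> \<open>Dressing matrices and their inverses\<close>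
  have u: "(\<Sum>\<^sub>\<infinity>j\<in>{1..}. u j) \<in> graded_in {..-1} Loc"
    using assms(2,19,20) by (intro graded_in_infsum graded_in_grade) auto
  note U = mexp_graded[OF R u, folded assms(7)]
  \<comment> \<open>Locality is assumed of the \<open>u j\<close> alone, hence \<open>UNIV\<close>
    here; \<open>S\<close> cancels from the dressed elements below.\<close>
  have s: "(\<Sum>\<^sub>\<infinity>j\<in>{1..}. s j) \<in> graded_in {..-1} UNIV"
    using assms(2,23) by (intro graded_in_infsum graded_in_grade) auto
  note S = mexp_graded[OF coefficient_ring_UNIV s, folded assms(8)]
  define U' where "U' = matrix_inv U"
  define S' where "S' = matrix_inv S"
  define \<Theta>' where "\<Theta>' = S' ** U'"
  have UU': "U ** U' = mat 1" "U' ** U = mat 1" and SS': "S ** S' = mat 1" "S' ** S = mat 1"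
    using U(3,4) S(3,4) by (simp_all add: U'_def S'_def)
  have cancel: "X ** S ** S' = X" "X ** U' ** U = X" "X ** U ** U' = X" for X :: "('f, 'n) lmat"
    using UU' SS' by (simp_all flip: matrix_mul_assoc)
  have inv: "\<Theta> ** \<Theta>' = mat 1" "\<Theta>' ** \<Theta> = mat 1"
    using UU' SS' by (simp_all add: assms(9) \<Theta>'_def matrix_mul_assoc cancel)
  then have \<Theta>_inv: "matrix_inv \<Theta> = \<Theta>'"
    by (rule matrix_inv_eqI)

  \<comment> \<open>Stated for every \<open>V\<close>, because it is applied to \<open>V = S\<close>
    in order to compose the two conjugations.\<close>
  have conjU: "coeffwise dx (U ** V) + (E + A) ** (U ** V) = U ** (coeffwise dx V + (E + Kminus) ** V)" for V
  proof -
    have "U' ** (coeffwise dx (U ** V) + (E + A) ** (U ** V)) = coeffwise dx V + (E + Kminus) ** V"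
      using fun_cong[OF assms(22), of V] by (simp add: conjugate_operator_def lax_operator_def U'_def)
    then have "U ** (U' ** (coeffwise dx (U ** V) + (E + A) ** (U ** V))) = U ** (coeffwise dx V + (E + Kminus) ** V)"
      by simp
    then show ?thesis
      unfolding matrix_mul_assoc[of U U'] UU' by simp
  qed
  \<comment> \<open>Evaluating the operators at the identity, which \<open>dx\<close> annihilates,
    extracts the differential equation of \<open>S\<close>.\<close>
  have "S' ** (coeffwise dx S + (E + Kminus) ** S) = E"
    using fun_cong[OF assms(24), of "mat 1"]
    by (simp add: conjugate_operator_def lax_operator_def S'_def coeffwise_d_mat_one[OF dx])
  then have "S ** (S' ** (coeffwise dx S + (E + Kminus) ** S)) = S ** E"
    by simp
  then have "coeffwise dx S + (E + Kminus) ** S = S ** E"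
    unfolding matrix_mul_assoc[of S S'] SS' by simp
  with conjU[of S] have dx_eq: "coeffwise dx \<Theta> + (E + A) ** \<Theta> = \<Theta> ** E"
    by (simp add: assms(9) matrix_mul_assoc)
  have dx\<Theta>: "coeffwise dx \<Theta> = - (E + A) ** \<Theta> + \<Theta> ** E"
    unfolding matrix_minus_left dx_eq[symmetric] by simp

  \<comment> \<open>Dressed elements of the center\<close>
  have dressed: "\<Theta> ** c ** \<Theta>' = U ** c ** U'" if "c \<in> center K" for c
  proof -
    \<comment> \<open>The \<open>s j\<close> lie in \<open>K\<close> and \<open>c\<close> is central
      there; hence \<open>c\<close> passes through \<open>S\<close>, and only the local factor
      \<open>U\<close> remains.\<close>
    have "c ** s j = s j ** c" if "j \<in> {1..}" for j
      using \<open>c \<in> center K\<close> assms(23)[of j] that by (auto simp: center_def lie_def)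
    then have "c ** S = S ** c"
      by (intro S(5) infsum_commute)
    then have "U ** S ** c ** S' ** U' = U ** c ** S ** S' ** U'"
      by (simp flip: matrix_mul_assoc)
    then show ?thesis
      by (simp add: assms(9) \<Theta>'_def matrix_mul_assoc cancel)
  qed
  have dressed_Loc: "U ** c ** U' \<in> graded_in UNIV Loc" if "c \<in> constants \<iota> \<inter> gr n" for c n
  proof -
    have "c \<in> graded_in UNIV Loc"
      using that constants_Loc assms(2) by (auto intro: graded_in_grade)
    then have "U ** c \<in> graded_in UNIV Loc"
      by (intro graded_in_mult[OF R _ U(1)]) auto
    then show ?thesis
      unfolding U'_def by (intro graded_in_mult[OF R _ _ U(2)]) auto
  qed

  \<comment> \<open>Time derivative of a single Hamiltonian\<close>
  show ?thesis
  proof (intro ballI allI impI)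
    fix m n c
    assume m: "m \<in> flows" and "0 < n" and c: "c \<in> constants \<iota> \<inter> center K \<inter> gr (int n)"
    define W where "W = U ** c ** U'"
    define P where "P = U ** b m ** U'"
    have b: "b m \<in> constants \<iota> \<inter> center K \<inter> gr (int m)"
      using assms(25)[OF m] .
    \<comment> \<open>The summand \<open>\<Theta> ** 0\<close> puts the flow equation into the form
      of \<open>derivative_dressed\<close> with \<open>e = 0\<close>.\<close>
    have dt: "derivation \<iota> (dt m)" and dt\<Theta>: "coeffwise (dt m) \<Theta> = negative_part \<iota> N H P ** \<Theta> + \<Theta> ** 0"
      using assms(27)[OF m] dressed[of "b m"] b by (simp_all add: isospectral_flow_def \<Theta>_inv P_def)
    have WP: "W = \<Theta> ** c ** \<Theta>'" "P = \<Theta> ** b m ** \<Theta>'"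
      using dressed b c by (simp_all add: W_def P_def)
    \<comment> \<open>The center lies in \<open>K\<close>, which is the kernel of
      \<open>ad E\<close>.\<close>
    have E_comm: "lie E c = 0" "lie E (b m) = 0"
      using b c by (simp_all add: center_def assms(4) ker_ad_def)
    have "lie (b m) c = 0"
      using b c by (simp add: center_def)
    then have "b m ** c = c ** b m"
      by (simp add: lie_def)
    moreover have "\<Theta> ** x ** \<Theta>' ** (\<Theta> ** y ** \<Theta>') = \<Theta> ** (x ** y) ** \<Theta>'" for x y
    proof -
      have "X ** \<Theta>' ** \<Theta> = X" for X :: "('f, 'n) lmat"
        using inv(2) by (simp flip: matrix_mul_assoc)
      then show ?thesis
        unfolding matrix_mul_assoc by simp
    qed
    ultimately have PW: "lie P W = 0"
      unfolding WP lie_def by simp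
    have dxW: "coeffwise dx W = - lie (E + A) W"
      using derivative_dressed[OF dx inv coeffwise_d_constants[OF dx] dx\<Theta> E_comm(1)] c
      unfolding WP lie_minus_left by blast
    have dxP: "coeffwise dx P = - lie (E + A) P"
      using derivative_dressed[OF dx inv coeffwise_d_constants[OF dx] dx\<Theta> E_comm(2)] b
      unfolding WP lie_minus_left by blast
    have "lie 0 c = 0"
      by (simp add: lie_def)
    then have dtW: "coeffwise (dt m) W = lie (negative_part \<iota> N H P) W"
      using derivative_dressed[OF dt inv coeffwise_d_constants[OF dt] dt\<Theta>] c
      unfolding WP(1) by blast
    have W: "W \<in> graded_in UNIV Loc" and P: "P \<in> graded_in UNIV Loc"
      unfolding W_def P_def using b c by (blast intro: dressed_Loc)+
    obtain J where J: "J \<in> Loc" "dt m (trace (coeff_matrix (E ** W) 0)) = dx J"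
      using density_flow_is_x_derivative[OF R dx dt E(1) coeffwise_d_constants[OF dt E_const] A P W dxP dxW dtW PW]
      by blast
    have EW: "E ** W \<in> graded_in UNIV Loc"
      by (rule graded_in_mult[OF R _ E(2) W]) simp
    have density: "hamiltonian_density \<iota> N H E U c = - trace (coeff_matrix (E ** W) 0)"
      using graded_trace_eq[OF R EW] by (simp add: hamiltonian_density_def W_def U'_def matrix_mul_assoc)
    \<comment> \<open>The rules for \<open>I\<close> hold on local expressions, so the density must
      be local before the flow enters the integral.\<close>
    then have "hamiltonian_density \<iota> N H E U c \<in> Loc"
      by (simp only: trace_def coeff_matrix_nth) (intro R_minus[OF R] R_sum[OF R] graded_in_entries[OF R EW])
    then have "dI m (I (hamiltonian_density \<iota> N H E U c)) = I (dt m (hamiltonian_density \<iota> N H E U c))"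
      using assms(29) m by (simp add: integration_def)
    also have "\<dots> = I (dx (- J))"
      by (simp add: density d_minus[OF dt] d_minus[OF dx] J(2))
    also have "\<dots> = 0"
      using assms(29) R_minus[OF R J(1)] by (simp add: integration_def)
    finally show "dI m (I (hamiltonian_density \<iota> N H E U c)) = 0" .
  qed
qed

end
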